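(* Let $X$ be a Grothendieck category with a small set of compact projective generators $S = \{ O_{\alpha} \mid \alpha \in A \}$. (1) Given a filter system $\{ \mathcal{F}_{\alpha} \}$ in the set of generators $\{ O_{\alpha} \}$, the subcategory $Z$ of $X$ generated by all objects $\{ O_{\alpha}/I_{\alpha} \mid \alpha\in A,\ I_{\alpha} \in \mathcal{F}_{\alpha} \}$ is a weakly closed subcategory of $X$. (2) Given a weakly closed subcategory $Z$ of $X$, let $\mathcal{F}_{\alpha}$ be the collection of all subobjects $I$ of $O_{\alpha}$ such that $O_{\alpha}/I \in Z$. Then $\mathcal{F}_{\alpha}$ is a filter in $O_{\alpha}$ and $\{ \mathcal{F}_{\alpha} \}$ is a filter system in $\{ O_{\alpha} \}$. (3) The operations in (1) and (2) give a bijective correspondence between weakly closed subcategories $Z$ of $X$ and filter systems $\{ \mathcal{F}_{\alpha} \}$ in the set of generators $S$. (4) In the correspondence of part (3), $Z$ is closed (resp. localizing) if and only if the filter system $\{ \mathcal{F}_{\alpha} \}$ is principal (resp. Gabriel).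
   Context: A Grothendieck category is an abelian category with arbitrary small direct sums, exact small filtered colimits, and a generator. A small set of objects $\{O_\alpha\}_{\alpha\in A}$ is a set of generators if $\bigoplus_\alpha O_\alpha$ is a generator, equivalently if every object of $X$ is an epimorphic image of a direct sum of objects taken from the set. An object $M$ is compact if $\operatorname{Hom}_X(M,-)$ commutes with arbitrary (small) direct sums. All subcategories are full. A full subcategory is weakly closed if it is closed under subobjects, quotient objects and small direct sums; localizing if it is weakly closed and closed under extensions; closed if it is weakly closed and closed under small products. The subcategory generated by a collection of objects is the full subcategory of all quotient objects of direct sums of objects in the collection. A filter inside an object $O$ is a collection $\mathcal{F}$ of subobjects of $O$ such that (i) $O\in\mathcal{F}$; (ii) if $I\subseteq J\subseteq O$ and $I\in\mathcal{F}$ then $J\in\mathcal{F}$; (iii) if $I,J\in\mathcal{F}$ then $I\cap J\in\mathcal{F}$. A filter $\mathcal{F}$ is principal if there is $I\in\mathcal{F}$ with $\mathcal{F}=\{J\subseteq O\mid I\subseteq J\}$. A filter system in the set of generators $\{O_\alpha\}$ is a choice of filter $\mathcal{F}_\alpha$ inside $O_\alpha$ for each $\alpha\in A$ such that for any morphism $f:O_\alpha\to O_\beta$, if $J\in\mathcal{F}_\beta$ then $f^{-1}(J)\in\mathcal{F}_\alpha$. A filter system is principal if every $\mathcal{F}_\alpha$ is principal. A filter system is Gabriel if, given any epimorphism $g:\bigoplus_i O_{\gamma_i}/I_{\gamma_i}\to J/K$ in $X$, where $K\subseteq J\subseteq O_\beta$, each $I_{\gamma_i}\in\mathcal{F}_{\gamma_i}$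 and $J\in\mathcal{F}_\beta$, then $K\in\mathcal{F}_\beta$. *)

theory Defs
  imports "HOL-Algebra.Product_Groups" "HOL-Algebra.Free_Abelian_Groups"
begin

unbundle cardinal_syntax

section \<open>Smallness\<close>

text \<open>
  Smallness is relative to a strongly inaccessible cardinal \<open>\<kappa>\<close>, i.e. to a
  Grothendieck universe: a set is small if its cardinality is below \<open>\<kappa>\<close>. Small families
  may always be re-indexed by small sets of the type \<open>'u\<close> underlying \<open>\<kappa>\<close>, so it
  suffices to quantify over such index sets. Uncountability of \<open>\<kappa>\<close> is not imposed, so that
  the universe of hereditarily finite sets is included as a (degenerate) case.
\<close>

definition inaccessible :: "'u rel \<Rightarrow> bool" where
  "inaccessible \<kappa> \<longleftrightarrow> Cinfinite \<kappa> \<and> regularCard \<kappa> \<and>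
     (\<forall>I::'u set. |I| <o \<kappa> \<longrightarrow> |Pow I| <o \<kappa>)"


section \<open>Categories\<close>

record ('o, 'm) category =
  Obj :: "'o set"
  Arr :: "'m set"
  Dom :: "'m \<Rightarrow> 'o"
  Cod :: "'m \<Rightarrow> 'o"
  Ident :: "'o \<Rightarrow> 'm"
  Comp :: "'m \<Rightarrow> 'm \<Rightarrow> 'm" (infixl "\<cdot>\<index>" 70)

definition Hom :: "('o, 'm, 'z) category_scheme \<Rightarrow> 'o \<Rightarrow> 'o \<Rightarrow> 'm set" where
  "Hom X a b = {f \<in> Arr X. Dom X f = a \<and> Cod X f = b}"

locale category =
  fixes X :: "('o, 'm, 'z) category_scheme" (structure)
  assumes Dom_Obj: "f \<in> Arr X \<Longrightarrow> Dom X f \<in> Obj X"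
    and Cod_Obj: "f \<in> Arr X \<Longrightarrow> Cod X f \<in> Obj X"
    and Ident_Hom: "a \<in> Obj X \<Longrightarrow> Ident X a \<in> Hom X a a"
    and Comp_Hom: "\<lbrakk>f \<in> Hom X a b; g \<in> Hom X b c\<rbrakk> \<Longrightarrow> g \<cdot> f \<in> Hom X a c"
    and Comp_assoc: "\<lbrakk>f \<in> Hom X a b; g \<in> Hom X b c; h \<in> Hom X c d\<rbrakk>
                       \<Longrightarrow> (h \<cdot> g) \<cdot> f = h \<cdot> (g \<cdot> f)"
    and Ident_left: "f \<in> Hom X a b \<Longrightarrow> Ident X b \<cdot> f = f"
    and Ident_right: "f \<in> Hom X a b \<Longrightarrow> f \<cdot> Ident X a = f"

definition mono_arr :: "('o, 'm, 'z) category_scheme \<Rightarrow> 'm \<Rightarrow> bool" where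
  "mono_arr X m \<longleftrightarrow> m \<in> Arr X \<and>
     (\<forall>t. \<forall>u \<in> Hom X t (Dom X m). \<forall>v \<in> Hom X t (Dom X m).
        m \<cdot>\<^bsub>X\<^esub> u = m \<cdot>\<^bsub>X\<^esub> v \<longrightarrow> u = v)"

definition epi_arr :: "('o, 'm, 'z) category_scheme \<Rightarrow> 'm \<Rightarrow> bool" where
  "epi_arr X e \<longleftrightarrow> e \<in> Arr X \<and>
     (\<forall>t. \<forall>u \<in> Hom X (Cod X e) t. \<forall>v \<in> Hom X (Cod X e) t.
        u \<cdot>\<^bsub>X\<^esub> e = v \<cdot>\<^bsub>X\<^esub> e \<longrightarrow> u = v)"

definition is_coproduct ::
  "('o, 'm, 'z) category_scheme \<Rightarrow> 'i set \<Rightarrow> ('i \<Rightarrow> 'o) \<Rightarrow> 'o \<Rightarrow> ('i \<Rightarrow> 'm) \<Rightarrow> bool" where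
  "is_coproduct X I N P \<iota> \<longleftrightarrow> P \<in> Obj X \<and> (\<forall>i\<in>I. \<iota> i \<in> Hom X (N i) P) \<and>
     (\<forall>t \<in> Obj X. \<forall>f. (\<forall>i\<in>I. f i \<in> Hom X (N i) t) \<longrightarrow>
        (\<exists>!h. h \<in> Hom X P t \<and> (\<forall>i\<in>I. h \<cdot>\<^bsub>X\<^esub> \<iota> i = f i)))"

definition is_product ::
  "('o, 'm, 'z) category_scheme \<Rightarrow> 'i set \<Rightarrow> ('i \<Rightarrow> 'o) \<Rightarrow> 'o \<Rightarrow> ('i \<Rightarrow> 'm) \<Rightarrow> bool" where
  "is_product X I N P \<pi> \<longleftrightarrow> P \<in> Obj X \<and> (\<forall>i\<in>I. \<pi> i \<in> Hom X P (N i)) \<and>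
     (\<forall>t \<in> Obj X. \<forall>f. (\<forall>i\<in>I. f i \<in> Hom X t (N i)) \<longrightarrow>
        (\<exists>!h. h \<in> Hom X t P \<and> (\<forall>i\<in>I. \<pi> i \<cdot>\<^bsub>X\<^esub> h = f i)))"

text \<open>\<open>p\<close>, \<open>q\<close> are the projections of a pullback of \<open>f\<close> and \<open>g\<close>.\<close>

definition is_pullback ::
  "('o, 'm, 'z) category_scheme \<Rightarrow> 'm \<Rightarrow> 'm \<Rightarrow> 'm \<Rightarrow> 'm \<Rightarrow> bool" where
  "is_pullback X f g p q \<longleftrightarrow>
     f \<in> Arr X \<and> g \<in> Hom X (Dom X g) (Cod X f) \<and>
     p \<in> Hom X (Dom X p) (Dom X f) \<and> q \<in> Hom X (Dom X p) (Dom X g) \<and>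
     f \<cdot>\<^bsub>X\<^esub> p = g \<cdot>\<^bsub>X\<^esub> q \<and>
     (\<forall>t. \<forall>u \<in> Hom X t (Dom X f). \<forall>v \<in> Hom X t (Dom X g). f \<cdot>\<^bsub>X\<^esub> u = g \<cdot>\<^bsub>X\<^esub> v \<longrightarrow>
        (\<exists>!w. w \<in> Hom X t (Dom X p) \<and> p \<cdot>\<^bsub>X\<^esub> w = u \<and> q \<cdot>\<^bsub>X\<^esub> w = v))"


section \<open>Filtered colimits\<close>

definition small_category :: "'u rel \<Rightarrow> ('j, 'n, 'y) category_scheme \<Rightarrow> bool" where
  "small_category \<kappa> J \<longleftrightarrow> category J \<and> |Obj J| <o \<kappa> \<and> |Arr J| <o \<kappa>"

definition filtered_category :: "('j, 'n, 'y) category_scheme \<Rightarrow> bool" where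
  "filtered_category J \<longleftrightarrow> category J \<and> Obj J \<noteq> {} \<and>
     (\<forall>i \<in> Obj J. \<forall>j \<in> Obj J. \<exists>k \<in> Obj J. Hom J i k \<noteq> {} \<and> Hom J j k \<noteq> {}) \<and>
     (\<forall>i j. \<forall>u \<in> Hom J i j. \<forall>v \<in> Hom J i j. \<exists>k. \<exists>w \<in> Hom J j k. w \<cdot>\<^bsub>J\<^esub> u = w \<cdot>\<^bsub>J\<^esub> v)"

definition is_functor ::
  "('j, 'n, 'y) category_scheme \<Rightarrow> ('o, 'm, 'z) category_scheme \<Rightarrow> ('j \<Rightarrow> 'o) \<Rightarrow> ('n \<Rightarrow> 'm) \<Rightarrow> bool" where
  "is_functor J X D D' \<longleftrightarrow> (\<forall>j \<in> Obj J. D j \<in> Obj X) \<and>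
     (\<forall>i j. \<forall>u \<in> Hom J i j. D' u \<in> Hom X (D i) (D j)) \<and>
     (\<forall>j \<in> Obj J. D' (Ident J j) = Ident X (D j)) \<and>
     (\<forall>i j k. \<forall>u \<in> Hom J i j. \<forall>v \<in> Hom J j k. D' (v \<cdot>\<^bsub>J\<^esub> u) = D' v \<cdot>\<^bsub>X\<^esub> D' u)"

definition is_nat_trans ::
  "('j, 'n, 'y) category_scheme \<Rightarrow> ('o, 'm, 'z) category_scheme \<Rightarrow> ('j \<Rightarrow> 'o) \<Rightarrow> ('n \<Rightarrow> 'm) \<Rightarrow>
     ('j \<Rightarrow> 'o) \<Rightarrow> ('n \<Rightarrow> 'm) \<Rightarrow> ('j \<Rightarrow> 'm) \<Rightarrow> bool" where
  "is_nat_trans J X D D' E E' s \<longleftrightarrow> (\<forall>j \<in> Obj J. s j \<in> Hom X (D j) (E j)) \<and>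
     (\<forall>i j. \<forall>u \<in> Hom J i j. s j \<cdot>\<^bsub>X\<^esub> D' u = E' u \<cdot>\<^bsub>X\<^esub> s i)"

definition is_cocone ::
  "('j, 'n, 'y) category_scheme \<Rightarrow> ('o, 'm, 'z) category_scheme \<Rightarrow> ('j \<Rightarrow> 'o) \<Rightarrow> ('n \<Rightarrow> 'm) \<Rightarrow>
     'o \<Rightarrow> ('j \<Rightarrow> 'm) \<Rightarrow> bool" where
  "is_cocone J X D D' C c \<longleftrightarrow> C \<in> Obj X \<and> (\<forall>j \<in> Obj J. c j \<in> Hom X (D j) C) \<and>
     (\<forall>i j. \<forall>u \<in> Hom J i j. c j \<cdot>\<^bsub>X\<^esub> D' u = c i)"

definition is_colimit ::
  "('j, 'n, 'y) category_scheme \<Rightarrow> ('o, 'm, 'z) category_scheme \<Rightarrow> ('j \<Rightarrow> 'o) \<Rightarrow> ('n \<Rightarrow> 'm) \<Rightarrow>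
     'o \<Rightarrow> ('j \<Rightarrow> 'm) \<Rightarrow> bool" where
  "is_colimit J X D D' C c \<longleftrightarrow> is_cocone J X D D' C c \<and>
     (\<forall>T t. is_cocone J X D D' T t \<longrightarrow>
        (\<exists>!h. h \<in> Hom X C T \<and> (\<forall>j \<in> Obj J. h \<cdot>\<^bsub>X\<^esub> c j = t j)))"


section \<open>Abelian categories\<close>

record ('o, 'm) ab_category = "('o, 'm) category" +
  Plus :: "'m \<Rightarrow> 'm \<Rightarrow> 'm"
  Zero :: "'o \<Rightarrow> 'o \<Rightarrow> 'm"

text \<open>The abelian group of morphisms, in the (multiplicatively written) group
  vocabulary of HOL-Algebra.\<close>

definition Hom_group :: "('o, 'm, 'z) ab_category_scheme \<Rightarrow> 'o \<Rightarrow> 'o \<Rightarrow> 'm monoid" where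
  "Hom_group X a b = \<lparr>carrier = Hom X a b, mult = Plus X, one = Zero X a b\<rparr>"

definition is_kernel :: "('o, 'm, 'z) ab_category_scheme \<Rightarrow> 'm \<Rightarrow> 'm \<Rightarrow> bool" where
  "is_kernel X f k \<longleftrightarrow> f \<in> Arr X \<and> k \<in> Hom X (Dom X k) (Dom X f) \<and>
     f \<cdot>\<^bsub>X\<^esub> k = Zero X (Dom X k) (Cod X f) \<and>
     (\<forall>t. \<forall>u \<in> Hom X t (Dom X f). f \<cdot>\<^bsub>X\<^esub> u = Zero X t (Cod X f) \<longrightarrow>
        (\<exists>!h. h \<in> Hom X t (Dom X k) \<and> k \<cdot>\<^bsub>X\<^esub> h = u))"

definition is_cokernel :: "('o, 'm, 'z) ab_category_scheme \<Rightarrow> 'm \<Rightarrow> 'm \<Rightarrow> bool" where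
  "is_cokernel X f q \<longleftrightarrow> f \<in> Arr X \<and> q \<in> Hom X (Cod X f) (Cod X q) \<and>
     q \<cdot>\<^bsub>X\<^esub> f = Zero X (Dom X f) (Cod X q) \<and>
     (\<forall>t. \<forall>u \<in> Hom X (Cod X f) t. u \<cdot>\<^bsub>X\<^esub> f = Zero X (Dom X f) t \<longrightarrow>
        (\<exists>!h. h \<in> Hom X (Cod X q) t \<and> h \<cdot>\<^bsub>X\<^esub> q = u))"

text \<open>\<open>0 \<rightarrow> Dom f \<rightarrow> Cod f = Dom g \<rightarrow> Cod g \<rightarrow> 0\<close> is exact.\<close>

definition short_exact :: "('o, 'm, 'z) ab_category_scheme \<Rightarrow> 'm \<Rightarrow> 'm \<Rightarrow> bool" where
  "short_exact X f g \<longleftrightarrow> is_kernel X g f \<and> is_cokernel X f g"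

locale preadditive_category = category X
  for X :: "('o, 'm, 'z) ab_category_scheme" (structure) +
  assumes Hom_comm_group: "\<lbrakk>a \<in> Obj X; b \<in> Obj X\<rbrakk> \<Longrightarrow> comm_group (Hom_group X a b)"
    and Comp_Plus_right: "\<lbrakk>f \<in> Hom X a b; f' \<in> Hom X a b; g \<in> Hom X b c\<rbrakk>
                            \<Longrightarrow> g \<cdot> Plus X f f' = Plus X (g \<cdot> f) (g \<cdot> f')"
    and Comp_Plus_left: "\<lbrakk>f \<in> Hom X a b; g \<in> Hom X b c; g' \<in> Hom X b c\<rbrakk>
                            \<Longrightarrow> Plus X g g' \<cdot> f = Plus X (g \<cdot> f) (g' \<cdot> f)"

locale abelian_category = preadditive_category X
  for X :: "('o, 'm, 'z) ab_category_scheme" (structure) +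
  assumes zero_object: "\<exists>z \<in> Obj X. Ident X z = Zero X z z"
    and biproducts: "\<lbrakk>a \<in> Obj X; b \<in> Obj X\<rbrakk> \<Longrightarrow>
           \<exists>s. \<exists>i \<in> Hom X a s. \<exists>j \<in> Hom X b s. \<exists>p \<in> Hom X s a. \<exists>q \<in> Hom X s b.
             p \<cdot> i = Ident X a \<and> q \<cdot> j = Ident X b \<and> Plus X (i \<cdot> p) (j \<cdot> q) = Ident X s"
    and kernels: "f \<in> Arr X \<Longrightarrow> \<exists>k. is_kernel X f k"
    and cokernels: "f \<in> Arr X \<Longrightarrow> \<exists>q. is_cokernel X f q"
    and mono_normal: "mono_arr X m \<Longrightarrow> \<exists>f. is_kernel X f m"
    and epi_normal: "epi_arr X e \<Longrightarrow> \<exists>f. is_cokernel X f e"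


section \<open>Grothendieck categories\<close>

definition is_generator :: "('o, 'm, 'z) category_scheme \<Rightarrow> 'o \<Rightarrow> bool" where
  "is_generator X G \<longleftrightarrow> G \<in> Obj X \<and>
     (\<forall>a b. \<forall>f \<in> Hom X a b. \<forall>g \<in> Hom X a b. f \<noteq> g \<longrightarrow>
        (\<exists>h \<in> Hom X G a. f \<cdot>\<^bsub>X\<^esub> h \<noteq> g \<cdot>\<^bsub>X\<^esub> h))"

text \<open>Homs are required to be small, as is implicit in speaking of categories.\<close>

locale grothendieck_category = abelian_category X
  for \<kappa> :: "'u rel" and X :: "('o, 'm, 'z) ab_category_scheme" (structure) +
  assumes inaccessible: "inaccessible \<kappa>"
    and small_Hom: "\<lbrakk>a \<in> Obj X; b \<in> Obj X\<rbrakk> \<Longrightarrow> |Hom X a b| <o \<kappa>"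
    and coproducts: "\<And>(I :: 'u set) N. \<lbrakk>|I| <o \<kappa>; \<forall>i\<in>I. N i \<in> Obj X\<rbrakk>
                       \<Longrightarrow> \<exists>P \<iota>. is_coproduct X I N P \<iota>"
    and filtered_colimits: "\<And>(J :: ('u, 'u) category) D D'.
           \<lbrakk>small_category \<kappa> J; filtered_category J; is_functor J X D D'\<rbrakk>
             \<Longrightarrow> \<exists>C c. is_colimit J X D D' C c"
    and filtered_colimits_exact: "\<And>(J :: ('u, 'u) category) D D' E E' F F' s t C c P p Q q f g.
           \<lbrakk>small_category \<kappa> J; filtered_category J;
            is_functor J X D D'; is_functor J X E E'; is_functor J X F F';
            is_nat_trans J X D D' E E' s; is_nat_trans J X E E' F F' t;
            \<forall>j \<in> Obj J. short_exact X (s j) (t j);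
            is_colimit J X D D' C c; is_colimit J X E E' P p; is_colimit J X F F' Q q;
            f \<in> Hom X C P; \<forall>j \<in> Obj J. f \<cdot> c j = p j \<cdot> s j;
            g \<in> Hom X P Q; \<forall>j \<in> Obj J. g \<cdot> p j = q j \<cdot> t j\<rbrakk>
             \<Longrightarrow> short_exact X f g"
    and generator: "\<exists>G. is_generator X G"

definition is_generating_family ::
  "('o, 'm, 'z) category_scheme \<Rightarrow> 'a set \<Rightarrow> ('a \<Rightarrow> 'o) \<Rightarrow> bool" where
  "is_generating_family X A G \<longleftrightarrow> (\<forall>\<alpha>\<in>A. G \<alpha> \<in> Obj X) \<and>
     (\<exists>P \<iota>. is_coproduct X A G P \<iota> \<and> is_generator X P)"

text \<open>The canonical homomorphism from the direct sum of the groups \<open>Hom M (N i)\<close> to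
  \<open>Hom M P\<close>, where \<open>P\<close> is the direct sum of the \<open>N i\<close>, is an isomorphism.
  (The direct sum \<^const>\<open>sum_group\<close> consists of families of finite support, to which
  \<^const>\<open>gfinprod\<close>, here written for a possibly infinite sum, applies.)\<close>

definition compact_object :: "'u rel \<Rightarrow> ('o, 'm, 'z) ab_category_scheme \<Rightarrow> 'o \<Rightarrow> bool" where
  "compact_object \<kappa> X M \<longleftrightarrow> M \<in> Obj X \<and>
     (\<forall>(I :: 'u set) N P \<iota>. |I| <o \<kappa> \<and> (\<forall>i\<in>I. N i \<in> Obj X) \<and> is_coproduct X I N P \<iota> \<longrightarrow>
        (\<lambda>x. gfinprod (Hom_group X M P) (\<lambda>i. \<iota> i \<cdot>\<^bsub>X\<^esub> x i) I)
          \<in> iso (sum_group I (\<lambda>i. Hom_group X M (N i))) (Hom_group X M P))"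

definition projective_object :: "('o, 'm, 'z) category_scheme \<Rightarrow> 'o \<Rightarrow> bool" where
  "projective_object X M \<longleftrightarrow> M \<in> Obj X \<and>
     (\<forall>e. epi_arr X e \<longrightarrow> (\<forall>f \<in> Hom X M (Cod X e). \<exists>h \<in> Hom X M (Dom X e). e \<cdot>\<^bsub>X\<^esub> h = f))"


section \<open>Full subcategories, given by their sets of objects\<close>

definition weakly_closed :: "'u rel \<Rightarrow> ('o, 'm, 'z) ab_category_scheme \<Rightarrow> 'o set \<Rightarrow> bool" where
  "weakly_closed \<kappa> X Z \<longleftrightarrow> Z \<subseteq> Obj X \<and>
     (\<forall>m. mono_arr X m \<and> Cod X m \<in> Z \<longrightarrow> Dom X m \<in> Z) \<and>
     (\<forall>e. epi_arr X e \<and> Dom X e \<in> Z \<longrightarrow> Cod X e \<in> Z) \<and>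
     (\<forall>(I :: 'u set) N P \<iota>. |I| <o \<kappa> \<and> (\<forall>i\<in>I. N i \<in> Z) \<and> is_coproduct X I N P \<iota> \<longrightarrow> P \<in> Z)"

definition localizing :: "'u rel \<Rightarrow> ('o, 'm, 'z) ab_category_scheme \<Rightarrow> 'o set \<Rightarrow> bool" where
  "localizing \<kappa> X Z \<longleftrightarrow> weakly_closed \<kappa> X Z \<and>
     (\<forall>f g. short_exact X f g \<and> Dom X f \<in> Z \<and> Cod X g \<in> Z \<longrightarrow> Cod X f \<in> Z)"

definition closed_subcategory :: "'u rel \<Rightarrow> ('o, 'm, 'z) ab_category_scheme \<Rightarrow> 'o set \<Rightarrow> bool" where
  "closed_subcategory \<kappa> X Z \<longleftrightarrow> weakly_closed \<kappa> X Z \<and>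
     (\<forall>(I :: 'u set) N P \<pi>. |I| <o \<kappa> \<and> (\<forall>i\<in>I. N i \<in> Z) \<and> is_product X I N P \<pi> \<longrightarrow> P \<in> Z)"

definition generated_subcategory :: "'u rel \<Rightarrow> ('o, 'm, 'z) ab_category_scheme \<Rightarrow> 'o set \<Rightarrow> 'o set" where
  "generated_subcategory \<kappa> X C =
     {M. \<exists>(I :: 'u set) N P \<iota> e. |I| <o \<kappa> \<and> (\<forall>i\<in>I. N i \<in> C) \<and> is_coproduct X I N P \<iota> \<and>
           epi_arr X e \<and> Dom X e = P \<and> Cod X e = M}"


section \<open>Subobjects\<close>

definition mono_le :: "('o, 'm, 'z) category_scheme \<Rightarrow> 'm \<Rightarrow> 'm \<Rightarrow> bool" where
  "mono_le X m n \<longleftrightarrow> (\<exists>h \<in> Hom X (Dom X m) (Dom X n). m = n \<cdot>\<^bsub>X\<^esub> h)"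

definition monos_into :: "('o, 'm, 'z) category_scheme \<Rightarrow> 'o \<Rightarrow> 'm set" where
  "monos_into X a = {m. mono_arr X m \<and> Cod X m = a}"

text \<open>A subobject is an equivalence class of monomorphisms.\<close>

definition subobjects :: "('o, 'm, 'z) category_scheme \<Rightarrow> 'o \<Rightarrow> 'm set set" where
  "subobjects X a = monos_into X a //
     {(m, n). m \<in> monos_into X a \<and> n \<in> monos_into X a \<and> mono_le X m n \<and> mono_le X n m}"

definition sub_le :: "('o, 'm, 'z) category_scheme \<Rightarrow> 'm set \<Rightarrow> 'm set \<Rightarrow> bool" where
  "sub_le X I J \<longleftrightarrow> (\<exists>m\<in>I. \<exists>n\<in>J. mono_le X m n)"

text \<open>The next two sets are the equivalence classes of all monomorphisms that represent
  \<open>I \<inter> J\<close> (the greatest lower bound) and \<open>f\<^sup>-\<^sup>1(J)\<close> (the pullback), respectively.\<close>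

definition sub_inter ::
  "('o, 'm, 'z) category_scheme \<Rightarrow> 'o \<Rightarrow> 'm set \<Rightarrow> 'm set \<Rightarrow> 'm set" where
  "sub_inter X a I J = {m \<in> monos_into X a.
     (\<exists>i\<in>I. mono_le X m i) \<and> (\<exists>j\<in>J. mono_le X m j) \<and>
     (\<forall>n \<in> monos_into X a. (\<exists>i\<in>I. mono_le X n i) \<and> (\<exists>j\<in>J. mono_le X n j) \<longrightarrow> mono_le X n m)}"

definition sub_preimage ::
  "('o, 'm, 'z) category_scheme \<Rightarrow> 'm \<Rightarrow> 'm set \<Rightarrow> 'm set" where
  "sub_preimage X f J = {m \<in> monos_into X (Dom X f). \<exists>j\<in>J. \<exists>h. is_pullback X f j m h}"

text \<open>\<open>Q\<close> is (a representative of) the quotient \<open>a/I\<close> of an object by a subobject, resp. the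
  subquotient \<open>J/K\<close> for subobjects \<open>K \<subseteq> J\<close>.\<close>

definition is_quotient ::
  "('o, 'm, 'z) ab_category_scheme \<Rightarrow> 'm set \<Rightarrow> 'o \<Rightarrow> bool" where
  "is_quotient X I Q \<longleftrightarrow> (\<exists>m\<in>I. \<exists>q. is_cokernel X m q \<and> Cod X q = Q)"

definition is_subquotient ::
  "('o, 'm, 'z) ab_category_scheme \<Rightarrow> 'm set \<Rightarrow> 'm set \<Rightarrow> 'o \<Rightarrow> bool" where
  "is_subquotient X J K Q \<longleftrightarrow>
     (\<exists>k\<in>K. \<exists>j\<in>J. \<exists>h \<in> Hom X (Dom X k) (Dom X j). k = j \<cdot>\<^bsub>X\<^esub> h \<and>
        (\<exists>q. is_cokernel X h q \<and> Cod X q = Q))"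


section \<open>Filter systems\<close>

definition sub_filter :: "('o, 'm, 'z) category_scheme \<Rightarrow> 'o \<Rightarrow> 'm set set \<Rightarrow> bool" where
  "sub_filter X a \<F> \<longleftrightarrow> \<F> \<subseteq> subobjects X a \<and>
     {m \<in> monos_into X a. mono_le X (Ident X a) m} \<in> \<F> \<and>
     (\<forall>I \<in> \<F>. \<forall>J \<in> subobjects X a. sub_le X I J \<longrightarrow> J \<in> \<F>) \<and>
     (\<forall>I \<in> \<F>. \<forall>J \<in> \<F>. sub_inter X a I J \<in> \<F>)"

definition principal_filter :: "('o, 'm, 'z) category_scheme \<Rightarrow> 'o \<Rightarrow> 'm set set \<Rightarrow> bool" where
  "principal_filter X a \<F> \<longleftrightarrow> (\<exists>I \<in> \<F>. \<F> = {J \<in> subobjects X a. sub_le X I J})"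

definition filter_system ::
  "('o, 'm, 'z) category_scheme \<Rightarrow> 'a set \<Rightarrow> ('a \<Rightarrow> 'o) \<Rightarrow> ('a \<Rightarrow> 'm set set) \<Rightarrow> bool" where
  "filter_system X A G \<F> \<longleftrightarrow> (\<forall>\<alpha>\<in>A. sub_filter X (G \<alpha>) (\<F> \<alpha>)) \<and>
     (\<forall>\<alpha>\<in>A. \<forall>\<beta>\<in>A. \<forall>f \<in> Hom X (G \<alpha>) (G \<beta>). \<forall>J \<in> \<F> \<beta>. sub_preimage X f J \<in> \<F> \<alpha>)"

definition principal_system ::
  "('o, 'm, 'z) category_scheme \<Rightarrow> 'a set \<Rightarrow> ('a \<Rightarrow> 'o) \<Rightarrow> ('a \<Rightarrow> 'm set set) \<Rightarrow> bool" where
  "principal_system X A G \<F> \<longleftrightarrow> (\<forall>\<alpha>\<in>A. principal_filter X (G \<alpha>) (\<F> \<alpha>))"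

definition gabriel_system ::
  "'u rel \<Rightarrow> ('o, 'm, 'z) ab_category_scheme \<Rightarrow> 'a set \<Rightarrow> ('a \<Rightarrow> 'o) \<Rightarrow> ('a \<Rightarrow> 'm set set) \<Rightarrow> bool" where
  "gabriel_system \<kappa> X A G \<F> \<longleftrightarrow>
     (\<forall>(L :: 'u set) \<gamma> I N P \<iota> \<beta> J K g.
        |L| <o \<kappa> \<and> (\<forall>i\<in>L. \<gamma> i \<in> A \<and> I i \<in> \<F> (\<gamma> i) \<and> is_quotient X (I i) (N i)) \<and>
        is_coproduct X L N P \<iota> \<and>
        \<beta> \<in> A \<and> J \<in> \<F> \<beta> \<and> K \<in> subobjects X (G \<beta>) \<and> sub_le X K J \<and>
        epi_arr X g \<and> Dom X g = P \<and> is_subquotient X J K (Cod X g)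
        \<longrightarrow> K \<in> \<F> \<beta>)"

text \<open>The two operations between filter systems and subcategories. Filter systems
  are identified if they agree on \<open>A\<close>, hence the use of \<^const>\<open>restrict\<close> and of
  \<^const>\<open>extensional\<close>.\<close>

definition subcategory_of_system ::
  "'u rel \<Rightarrow> ('o, 'm, 'z) ab_category_scheme \<Rightarrow> 'a set \<Rightarrow> ('a \<Rightarrow> 'm set set) \<Rightarrow> 'o set" where
  "subcategory_of_system \<kappa> X A \<F> =
     generated_subcategory \<kappa> X {Q. \<exists>\<alpha>\<in>A. \<exists>I \<in> \<F> \<alpha>. is_quotient X I Q}"

definition system_of_subcategory ::
  "('o, 'm, 'z) ab_category_scheme \<Rightarrow> 'a set \<Rightarrow> ('a \<Rightarrow> 'o) \<Rightarrow> 'o set \<Rightarrow> ('a \<Rightarrow> 'm set set)" where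
  "system_of_subcategory X A G Z =
     (\<lambda>\<alpha>\<in>A. {I \<in> subobjects X (G \<alpha>). \<exists>Q\<in>Z. is_quotient X I Q})"

definition filter_systems ::
  "('o, 'm, 'z) category_scheme \<Rightarrow> 'a set \<Rightarrow> ('a \<Rightarrow> 'o) \<Rightarrow> ('a \<Rightarrow> 'm set set) set" where
  "filter_systems X A G = {\<F> \<in> extensional A. filter_system X A G \<F>}"

definition weakly_closed_subcategories ::
  "'u rel \<Rightarrow> ('o, 'm, 'z) ab_category_scheme \<Rightarrow> 'o set set" where
  "weakly_closed_subcategories \<kappa> X = {Z. weakly_closed \<kappa> X Z}"

end

theory Submission
  imports Defs
begin

text \<open>
  Call a morphism from some \<open>G \<alpha>\<close> to \<open>M\<close> an element of \<open>M\<close>. As the \<open>G \<alpha>\<close> are projective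
  generators, monomorphisms, epimorphisms and exactness can be tested on elements, and as they
  are compact, an element of a coproduct is a finite sum of elements of the summands. So the
  subcategory generated by the quotients \<open>G \<alpha>/I\<close> with \<open>I \<in> \<F> \<alpha>\<close> consists of the objects all of
  whose elements have a kernel in \<open>\<F>\<close>: the kernel of an element of a quotient of a coproduct of
  such \<open>G \<gamma>/I\<close> contains a finite intersection of preimages of members of \<open>\<F>\<close>. If \<open>\<F>\<close> is principal, the
  kernel of an element of a product is the intersection of kernels that all contain the smallest
  member; conversely the map from \<open>G \<alpha>\<close> to the product of all \<open>G \<alpha>/I\<close> has the smallest member as
  its kernel. The Gabriel condition expresses closure under extensions of the form
  \<open>0 \<rightarrow> J/K \<rightarrow> G \<beta>/K \<rightarrow> G \<beta>/J \<rightarrow> 0\<close>, to which all others reduce elementwise.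
\<close>

section \<open>Kernels as subobjects\<close>

text \<open>A subobject is by definition a whole equivalence class of monomorphisms, so
  intersections and preimages are sets of representatives and awkward to compute with. But every
  subobject of \<open>a\<close> consists of all kernels of some epimorphism \<open>q\<close> out of
  \<open>a\<close>. Written as \<open>kernel_class X q\<close>, its order, intersections and
  preimages become statements about which \<open>u\<close> satisfy q \<cdot> u = 0, and the filter
  axioms become rules about morphisms. Smallness shapes the rest. Coproducts are given only over
  small index sets of type \<open>'u\<close>, so families indexed by elements, by families of
  elements or by members of a filter must first be counted and re-indexed. Each member of a filter
  may itself be a large set of arrows; the members are counted through the elements that they
  annihilate. Products are not among the axioms of a Grothendieck category, yet the passage from
  closed subcategories to principal systems needs one, so it is built from generators, coproducts
  and a cokernel.\<close>

lemma Hom_iff: "f \<in> Hom X a b \<longleftrightarrow> f \<in> Arr X \<and> Dom X f = a \<and> Cod X f = b"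
  by (simp add: Hom_def)

lemma ex1_unique: "\<lbrakk>\<exists>!x. P x; P a; P b\<rbrakk> \<Longrightarrow> a = b"
  by auto

lemma HomD:
  assumes "f \<in> Hom X a b" shows "f \<in> Arr X" "Dom X f = a" "Cod X f = b"
  using assms by (auto simp: Hom_iff)

text \<open>The definitions refer to \<open>Dom X f\<close> and \<open>Cod X f\<close>. Here and in
  the next two lemmas named objects replace them, so that later goals only concern membership in
  Hom-sets.\<close>

lemma is_kernel_iff:
  assumes "f \<in> Hom X a b"
  shows "is_kernel X f k \<longleftrightarrow> k \<in> Hom X (Dom X k) a \<and> f \<cdot>\<^bsub>X\<^esub> k = Zero X (Dom X k) b \<and>
    (\<forall>t. \<forall>u \<in> Hom X t a. f \<cdot>\<^bsub>X\<^esub> u = Zero X t b \<longrightarrow> (\<exists>!h. h \<in> Hom X t (Dom X k) \<and> k \<cdot>\<^bsub>X\<^esub> h = u))"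
  unfolding is_kernel_def HomD(2,3)[OF assms] using HomD(1)[OF assms] by simp

lemma is_cokernel_iff:
  assumes "f \<in> Hom X a b"
  shows "is_cokernel X f q \<longleftrightarrow> q \<in> Hom X b (Cod X q) \<and> q \<cdot>\<^bsub>X\<^esub> f = Zero X a (Cod X q) \<and>
    (\<forall>t. \<forall>u \<in> Hom X b t. u \<cdot>\<^bsub>X\<^esub> f = Zero X a t \<longrightarrow> (\<exists>!h. h \<in> Hom X (Cod X q) t \<and> h \<cdot>\<^bsub>X\<^esub> q = u))"
  unfolding is_cokernel_def HomD(2,3)[OF assms] using HomD(1)[OF assms] by simp

lemma is_pullback_iff:
  assumes "f \<in> Hom X a c" "g \<in> Hom X b c"
  shows "is_pullback X f g p q \<longleftrightarrow> p \<in> Hom X (Dom X p) a \<and> q \<in> Hom X (Dom X p) b \<and>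
    f \<cdot>\<^bsub>X\<^esub> p = g \<cdot>\<^bsub>X\<^esub> q \<and> (\<forall>t. \<forall>u \<in> Hom X t a. \<forall>v \<in> Hom X t b. f \<cdot>\<^bsub>X\<^esub> u = g \<cdot>\<^bsub>X\<^esub> v \<longrightarrow>
        (\<exists>!w. w \<in> Hom X t (Dom X p) \<and> p \<cdot>\<^bsub>X\<^esub> w = u \<and> q \<cdot>\<^bsub>X\<^esub> w = v))"
  unfolding is_pullback_def HomD(2,3)[OF assms(1)] HomD(2,3)[OF assms(2)]
  using HomD(1)[OF assms(1)] assms by simp

section \<open>Monomorphisms, subobjects and universal properties in a category\<close>

context category
begin

lemma Hom_Obj: assumes "f \<in> Hom X a b" shows "a \<in> Obj X" "b \<in> Obj X"
  using assms Dom_Obj Cod_Obj by (auto simp: Hom_iff)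

lemma mono_cancel:
  "\<lbrakk>mono_arr X m; m \<in> Hom X a b; u \<in> Hom X t a; v \<in> Hom X t a; m \<cdot> u = m \<cdot> v\<rbrakk> \<Longrightarrow> u = v"
  by (auto simp: mono_arr_def Hom_iff)

lemma epi_cancel:
  "\<lbrakk>epi_arr X e; e \<in> Hom X a b; u \<in> Hom X b t; v \<in> Hom X b t; u \<cdot> e = v \<cdot> e\<rbrakk> \<Longrightarrow> u = v"
  by (auto simp: epi_arr_def Hom_iff)

lemma mono_arrI:
  assumes "m \<in> Hom X a b"
    and "\<And>t u v. \<lbrakk>u \<in> Hom X t a; v \<in> Hom X t a; m \<cdot> u = m \<cdot> v\<rbrakk> \<Longrightarrow> u = v"
  shows "mono_arr X m"
  using assms unfolding mono_arr_def by (auto simp: Hom_iff)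

lemma epi_arrI:
  assumes "e \<in> Hom X a b"
    and "\<And>t u v. \<lbrakk>u \<in> Hom X b t; v \<in> Hom X b t; u \<cdot> e = v \<cdot> e\<rbrakk> \<Longrightarrow> u = v"
  shows "epi_arr X e"
  using assms unfolding epi_arr_def by (auto simp: Hom_iff)

lemma monos_into_Hom: "m \<in> monos_into X a \<Longrightarrow> m \<in> Hom X (Dom X m) a"
  by (auto simp: monos_into_def mono_arr_def Hom_iff)

lemma mono_le_refl: "m \<in> Hom X a b \<Longrightarrow> mono_le X m m"
  using Ident_Hom[of a] Ident_right[of m a b] Hom_Obj[of m a b] HomD(2)[of m X a b]
  unfolding mono_le_def by metis

lemma mono_le_trans:
  assumes "mono_le X l m" "mono_le X m n" "n \<in> Hom X b a"
  shows "mono_le X l n"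
proof -
  obtain h where h: "h \<in> Hom X (Dom X l) (Dom X m)" "l = m \<cdot> h"
    using assms(1) by (auto simp: mono_le_def)
  obtain k where k: "k \<in> Hom X (Dom X m) (Dom X n)" "m = n \<cdot> k"
    using assms(2) by (auto simp: mono_le_def)
  have n: "n \<in> Hom X (Dom X n) a"
    using assms(3) by (auto simp: Hom_iff)
  have "l = n \<cdot> (k \<cdot> h)"
    using Comp_assoc[OF h(1) k(1) n] h(2) k(2) by simp
  then show ?thesis
    using Comp_Hom[OF h(1) k(1)] by (auto simp: mono_le_def)
qed

lemma subobjectsE:
  assumes "I \<in> subobjects X a"
  obtains m where "m \<in> monos_into X a" "I = {n \<in> monos_into X a. mono_le X m n \<and> mono_le X n m}"
  using assms unfolding subobjects_def by (auto elim!: quotientE)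

lemma subobjectsI:
  assumes "m \<in> monos_into X a"
  shows "{n \<in> monos_into X a. mono_le X m n \<and> mono_le X n m} \<in> subobjects X a"
proof -
  have eq: "{n \<in> monos_into X a. mono_le X m n \<and> mono_le X n m} =
    {(m, n). m \<in> monos_into X a \<and> n \<in> monos_into X a \<and> mono_le X m n \<and> mono_le X n m} `` {m}"
    using assms by auto
  show ?thesis
    unfolding subobjects_def eq by (rule quotientI[OF assms])
qed

lemma coproduct_inj: "\<lbrakk>is_coproduct X I N P \<iota>; i \<in> I\<rbrakk> \<Longrightarrow> \<iota> i \<in> Hom X (N i) P"
  by (auto simp: is_coproduct_def)

lemma coproduct_ex1:
  assumes "is_coproduct X I N P \<iota>" "t \<in> Obj X" "\<And>i. i \<in> I \<Longrightarrow> f i \<in> Hom X (N i) t"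
  shows "\<exists>!h. h \<in> Hom X P t \<and> (\<forall>i\<in>I. h \<cdot> \<iota> i = f i)"
  using assms by (simp add: is_coproduct_def)

lemma coproduct_induced:
  assumes "is_coproduct X I N P \<iota>" "t \<in> Obj X" "\<And>i. i \<in> I \<Longrightarrow> f i \<in> Hom X (N i) t"
  obtains h where "h \<in> Hom X P t" "\<And>i. i \<in> I \<Longrightarrow> h \<cdot> \<iota> i = f i"
  using ex1_implies_ex[OF coproduct_ex1[of I N P \<iota> t f, OF assms]] by blast

lemma coproduct_eqI:
  assumes c: "is_coproduct X I N P \<iota>" and h: "h \<in> Hom X P t" "h' \<in> Hom X P t"
    and eq: "\<And>i. i \<in> I \<Longrightarrow> h \<cdot> \<iota> i = h' \<cdot> \<iota> i"
  shows "h = h'"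
proof -
  have "h \<cdot> \<iota> i \<in> Hom X (N i) t" if "i \<in> I" for i
    using Comp_Hom[OF coproduct_inj[OF c that] h(1)] .
  then have "\<exists>!k. k \<in> Hom X P t \<and> (\<forall>i\<in>I. k \<cdot> \<iota> i = h \<cdot> \<iota> i)"
    by (rule coproduct_ex1[OF c Hom_Obj(2)[OF h(1)]])
  moreover have "h \<in> Hom X P t \<and> (\<forall>i\<in>I. h \<cdot> \<iota> i = h \<cdot> \<iota> i)" "h' \<in> Hom X P t \<and> (\<forall>i\<in>I. h' \<cdot> \<iota> i = h \<cdot> \<iota> i)"
    using h eq by simp_all
  ultimately show ?thesis by (rule ex1_unique)
qed

lemma product_proj: "\<lbrakk>is_product X I N P \<pi>; i \<in> I\<rbrakk> \<Longrightarrow> \<pi> i \<in> Hom X P (N i)"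
  by (auto simp: is_product_def)

lemma product_ex1:
  assumes "is_product X I N P \<pi>" "t \<in> Obj X" "\<And>i. i \<in> I \<Longrightarrow> f i \<in> Hom X t (N i)"
  shows "\<exists>!h. h \<in> Hom X t P \<and> (\<forall>i\<in>I. \<pi> i \<cdot> h = f i)"
  using assms by (simp add: is_product_def)

lemma product_eqI:
  assumes c: "is_product X I N P \<pi>" and h: "h \<in> Hom X t P" "h' \<in> Hom X t P"
    and eq: "\<And>i. i \<in> I \<Longrightarrow> \<pi> i \<cdot> h = \<pi> i \<cdot> h'"
  shows "h = h'"
proof -
  have "\<pi> i \<cdot> h \<in> Hom X t (N i)" if "i \<in> I" for i
    using Comp_Hom[OF h(1) product_proj[OF c that]] .
  then have "\<exists>!k. k \<in> Hom X t P \<and> (\<forall>i\<in>I. \<pi> i \<cdot> k = \<pi> i \<cdot> h)"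
    by (rule product_ex1[OF c Hom_Obj(1)[OF h(1)]])
  moreover have "h \<in> Hom X t P \<and> (\<forall>i\<in>I. \<pi> i \<cdot> h = \<pi> i \<cdot> h)" "h' \<in> Hom X t P \<and> (\<forall>i\<in>I. \<pi> i \<cdot> h' = \<pi> i \<cdot> h)"
    using h eq by simp_all
  ultimately show ?thesis by (rule ex1_unique)
qed

end

text \<open>No kernel is chosen: all of them together form one equivalence class of monomorphisms,
  hence a subobject in the sense of \<open>subobjects\<close>.\<close>

definition kernel_class :: "('o, 'm, 'z) ab_category_scheme \<Rightarrow> 'm \<Rightarrow> 'm set" where
  "kernel_class X f = {k. is_kernel X f k}"

text \<open>For morphisms with the same domain this is the inclusion of the kernel of
  \<open>f\<close> in that of \<open>g\<close>, stated through generalized elements so that it is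
  checked by composing arrows.\<close>

definition kernel_le :: "('o, 'm, 'z) ab_category_scheme \<Rightarrow> 'm \<Rightarrow> 'm \<Rightarrow> bool" where
  "kernel_le X f g \<longleftrightarrow> (\<forall>t. \<forall>u \<in> Hom X t (Dom X f).
     f \<cdot>\<^bsub>X\<^esub> u = Zero X t (Cod X f) \<longrightarrow> g \<cdot>\<^bsub>X\<^esub> u = Zero X t (Cod X g))"

section \<open>Zero morphisms, kernels and cokernels\<close>

context preadditive_category
begin

lemma Zero_Hom: "\<lbrakk>a \<in> Obj X; b \<in> Obj X\<rbrakk> \<Longrightarrow> Zero X a b \<in> Hom X a b"
  using comm_group.axioms(2)[OF Hom_comm_group, THEN group.is_monoid, THEN monoid.one_closed]
  by (force simp: Hom_group_def)

lemma Plus_Hom: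
  assumes "f \<in> Hom X a b" "g \<in> Hom X a b" shows "Plus X f g \<in> Hom X a b"
proof -
  interpret comm_group "Hom_group X a b" using Hom_comm_group Hom_Obj assms by blast
  show ?thesis using m_closed[of f g] assms by (simp add: Hom_group_def)
qed

lemma Plus_Zero:
  assumes "f \<in> Hom X a b" shows "Plus X f (Zero X a b) = f" "Plus X (Zero X a b) f = f"
proof -
  interpret comm_group "Hom_group X a b" using Hom_comm_group Hom_Obj assms by blast
  show "Plus X f (Zero X a b) = f" "Plus X (Zero X a b) f = f"
    using r_one[of f] l_one[of f] assms by (simp_all add: Hom_group_def)
qed

lemma Plus_self_iff:
  assumes "f \<in> Hom X a b" "Plus X f f = f" shows "f = Zero X a b"
proof -
  interpret comm_group "Hom_group X a b" using Hom_comm_group Hom_Obj assms by blast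
  show ?thesis using l_cancel_one[of f f] assms by (simp add: Hom_group_def)
qed

text \<open>The record has no negation, so a difference is obtained from the inverse of
  \<open>Hom_group\<close> and used only through \<open>f\<close> = \<open>g\<close> +
  \<open>d\<close>.\<close>

lemma difference:
  assumes "f \<in> Hom X a b" "g \<in> Hom X a b"
  obtains d where "d \<in> Hom X a b" "f = Plus X g d"
proof -
  interpret comm_group "Hom_group X a b" using Hom_comm_group Hom_Obj assms by blast
  show ?thesis
  proof (rule that)
    show "inv\<^bsub>Hom_group X a b\<^esub> g \<otimes>\<^bsub>Hom_group X a b\<^esub> f \<in> Hom X a b"
      using m_closed[of "inv\<^bsub>Hom_group X a b\<^esub> g" f] inv_closed[of g] assms by (simp add: Hom_group_def)
    show "f = Plus X g (inv\<^bsub>Hom_group X a b\<^esub> g \<otimes>\<^bsub>Hom_group X a b\<^esub> f)"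
      using inv_solve_left[of "inv\<^bsub>Hom_group X a b\<^esub> g \<otimes>\<^bsub>Hom_group X a b\<^esub> f" g f]
        m_closed[of "inv\<^bsub>Hom_group X a b\<^esub> g" f] inv_closed[of g] assms by (simp add: Hom_group_def)
  qed
qed

lemma Plus_left_cancel:
  assumes "f \<in> Hom X a b" "d \<in> Hom X a b" "Plus X f d = f"
  shows "d = Zero X a b"
proof -
  interpret comm_group "Hom_group X a b" using Hom_comm_group Hom_Obj assms by blast
  show ?thesis using l_cancel_one[of f d] assms by (simp add: Hom_group_def)
qed

text \<open>Only additivity of composition is assumed. From 0 + 0 = 0 the composite satisfies z + z
  = z, and in a group this forces z = 0.\<close>

lemma Comp_Zero:
  assumes "g \<in> Hom X b c" "a \<in> Obj X" shows "g \<cdot> Zero X a b = Zero X a c"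
proof -
  have z: "Zero X a b \<in> Hom X a b" using assms Hom_Obj Zero_Hom by blast
  show ?thesis
    using Comp_Plus_right[OF z z assms(1)] Plus_Zero[OF z] Plus_self_iff[OF Comp_Hom[OF z assms(1)]]
    by simp
qed

lemma Zero_Comp:
  assumes "f \<in> Hom X a b" "c \<in> Obj X" shows "Zero X b c \<cdot> f = Zero X a c"
proof -
  have z: "Zero X b c \<in> Hom X b c" using assms Hom_Obj Zero_Hom by blast
  show ?thesis
    using Comp_Plus_left[OF assms(1) z z] Plus_Zero[OF z] Plus_self_iff[OF Comp_Hom[OF assms(1) z]]
    by simp
qed

lemma mono_Comp_Zero_iff:
  assumes "mono_arr X m" "m \<in> Hom X a b" "u \<in> Hom X t a"
  shows "m \<cdot> u = Zero X t b \<longleftrightarrow> u = Zero X t a"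
proof -
  have "t \<in> Obj X" "a \<in> Obj X" using assms(3) Hom_Obj by auto
  then show ?thesis
    using mono_cancel[OF assms Zero_Hom] Comp_Zero[OF assms(2)] by metis
qed

lemma kernel_Hom:
  assumes "is_kernel X f k" "f \<in> Hom X a b"
  shows "k \<in> Hom X (Dom X k) a" "f \<cdot> k = Zero X (Dom X k) b"
  using assms(1) unfolding is_kernel_iff[OF assms(2)] by auto

lemma kernel_lift:
  assumes "is_kernel X f k" "f \<in> Hom X a b" "u \<in> Hom X t a" "f \<cdot> u = Zero X t b"
  obtains h where "h \<in> Hom X t (Dom X k)" "k \<cdot> h = u"
  using assms(1,3,4) unfolding is_kernel_iff[OF assms(2)] by blast

lemma kernel_mono:
  assumes "is_kernel X f k" shows "mono_arr X k"
proof -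
  have f: "f \<in> Hom X (Dom X f) (Cod X f)" using assms by (auto simp: is_kernel_def Hom_iff)
  note k = kernel_Hom[OF assms f]
  show ?thesis
  proof (rule mono_arrI[OF k(1)])
    fix t u v assume u: "u \<in> Hom X t (Dom X k)" "v \<in> Hom X t (Dom X k)" "k \<cdot> u = k \<cdot> v"
    have "f \<cdot> (k \<cdot> u) = Zero X t (Cod X f)"
      using Comp_assoc[OF u(1) k(1) f] k(2) Zero_Comp[OF u(1)] Hom_Obj(2)[OF f] by simp
    then have "\<exists>!h. h \<in> Hom X t (Dom X k) \<and> k \<cdot> h = k \<cdot> u"
      using assms Comp_Hom[OF u(1) k(1)] unfolding is_kernel_def by blast
    then show "u = v" using u by auto
  qed
qed

lemma cokernel_Hom:
  assumes "is_cokernel X f q" "f \<in> Hom X a b"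
  shows "q \<in> Hom X b (Cod X q)" "q \<cdot> f = Zero X a (Cod X q)"
  using assms(1) unfolding is_cokernel_iff[OF assms(2)] by auto

lemma cokernel_desc:
  assumes "is_cokernel X f q" "f \<in> Hom X a b" "u \<in> Hom X b t" "u \<cdot> f = Zero X a t"
  obtains h where "h \<in> Hom X (Cod X q) t" "h \<cdot> q = u"
  using assms(1,3,4) unfolding is_cokernel_iff[OF assms(2)] by blast

lemma cokernel_epi:
  assumes "is_cokernel X f q" shows "epi_arr X q"
proof -
  have f: "f \<in> Hom X (Dom X f) (Cod X f)" using assms by (auto simp: is_cokernel_def Hom_iff)
  note k = cokernel_Hom[OF assms f]
  show ?thesis
  proof (rule epi_arrI[OF k(1)])
    fix t u v assume u: "u \<in> Hom X (Cod X q) t" "v \<in> Hom X (Cod X q) t" "u \<cdot> q = v \<cdot> q"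
    have "(u \<cdot> q) \<cdot> f = Zero X (Dom X f) t"
      using Comp_assoc[OF f k(1) u(1)] k(2) Comp_Zero[OF u(1)] Hom_Obj(1)[OF f] by simp
    then have "\<exists>!h. h \<in> Hom X (Cod X q) t \<and> h \<cdot> q = u \<cdot> q"
      using assms Comp_Hom[OF k(1) u(1)] unfolding is_cokernel_def by blast
    then show "u = v" using u by auto
  qed
qed

text \<open>The kernel \<open>k\<close> is the universal morphism annihilated by \<open>f\<close>,
  so testing \<open>g\<close> on \<open>k\<close> alone decides the inclusion.\<close>

lemma kernel_le_iff:
  assumes "is_kernel X f k" "f \<in> Hom X a b" "g \<in> Hom X a c"
  shows "kernel_le X f g \<longleftrightarrow> g \<cdot> k = Zero X (Dom X k) c"
proof
  assume "kernel_le X f g"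
  then show "g \<cdot> k = Zero X (Dom X k) c"
    using kernel_Hom[OF assms(1,2)] assms unfolding kernel_le_def by (auto simp: Hom_iff)
next
  assume gk: "g \<cdot> k = Zero X (Dom X k) c"
  show "kernel_le X f g"
    unfolding kernel_le_def
  proof (intro allI ballI impI)
    fix t u assume "u \<in> Hom X t (Dom X f)" "f \<cdot> u = Zero X t (Cod X f)"
    then have u: "u \<in> Hom X t a" "f \<cdot> u = Zero X t b" using assms(2) by (auto simp: Hom_iff)
    obtain h where h: "h \<in> Hom X t (Dom X k)" "k \<cdot> h = u" using kernel_lift[OF assms(1,2) u] .
    have "g \<cdot> u = Zero X t c"
      using Comp_assoc[OF h(1) kernel_Hom(1)[OF assms(1,2)] assms(3)] gk h(2) Zero_Comp[OF h(1)]
        Hom_Obj(2)[OF assms(3)] by simp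
    then show "g \<cdot> u = Zero X t (Cod X g)" using assms(3) by (auto simp: Hom_iff)
  qed
qed

lemma kernel_leD:
  assumes "kernel_le X f g" "f \<in> Hom X a b" "g \<in> Hom X a c" "u \<in> Hom X t a" "f \<cdot> u = Zero X t b"
  shows "g \<cdot> u = Zero X t c"
  using assms unfolding kernel_le_def by (auto simp: Hom_iff)

lemma kernel_leI:
  assumes "f \<in> Hom X a b" "g \<in> Hom X a c"
    and "\<And>t u. \<lbrakk>u \<in> Hom X t a; f \<cdot> u = Zero X t b\<rbrakk> \<Longrightarrow> g \<cdot> u = Zero X t c"
  shows "kernel_le X f g"
  using assms unfolding kernel_le_def by (auto simp: Hom_iff)

lemma kernel_le_refl: "kernel_le X f f"
  by (simp add: kernel_le_def)

lemma kernel_mono_le_iff: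
  assumes k: "is_kernel X f k" "f \<in> Hom X a b" and l: "is_kernel X g l" "g \<in> Hom X a c"
  shows "mono_le X k l \<longleftrightarrow> kernel_le X f g"
proof -
  note k' = kernel_Hom[OF k] and l' = kernel_Hom[OF l]
  have "mono_le X k l \<longleftrightarrow> g \<cdot> k = Zero X (Dom X k) c"
  proof
    assume "mono_le X k l"
    then obtain h where h: "h \<in> Hom X (Dom X k) (Dom X l)" "k = l \<cdot> h" by (auto simp: mono_le_def)
    then show "g \<cdot> k = Zero X (Dom X k) c"
      using Comp_assoc[OF h(1) l'(1) l(2)] l'(2) Zero_Comp[OF h(1)] Hom_Obj(2)[OF l(2)] by simp
  next
    assume "g \<cdot> k = Zero X (Dom X k) c"
    then show "mono_le X k l" using kernel_lift[OF l k'(1)] unfolding mono_le_def by blast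
  qed
  then show ?thesis using kernel_le_iff[OF k l(2)] by simp
qed

lemma kernel_monos_into: "\<lbrakk>is_kernel X f k; f \<in> Hom X a b\<rbrakk> \<Longrightarrow> k \<in> monos_into X a"
  using kernel_mono[of f k] kernel_Hom[of f k a b] by (auto simp: monos_into_def Hom_iff)

text \<open>The comparison maps between \<open>k\<close> and \<open>n\<close> transport the
  factorizations. This is why the kernels of \<open>f\<close> fill a whole equivalence
  class.\<close>

lemma kernel_if_equiv:
  assumes k: "is_kernel X f k" "f \<in> Hom X a b" and n: "n \<in> monos_into X a" "mono_le X k n" "mono_le X n k"
  shows "is_kernel X f n"
proof -
  note k' = kernel_Hom[OF k]
  have n': "n \<in> Hom X (Dom X n) a" "mono_arr X n" using n by (auto simp: monos_into_def mono_arr_def Hom_iff)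
  obtain h where h: "h \<in> Hom X (Dom X k) (Dom X n)" "k = n \<cdot> h" using n by (auto simp: mono_le_def)
  obtain h' where h': "h' \<in> Hom X (Dom X n) (Dom X k)" "n = k \<cdot> h'" using n by (auto simp: mono_le_def)
  have "f \<cdot> n = Zero X (Dom X n) b"
    using Comp_assoc[OF h'(1) k'(1) k(2)] h'(2) k'(2) Zero_Comp[OF h'(1)] Hom_Obj(2)[OF k(2)] by simp
  moreover have "\<exists>!w. w \<in> Hom X t (Dom X n) \<and> n \<cdot> w = u"
    if u: "u \<in> Hom X t a" "f \<cdot> u = Zero X t b" for t u
  proof -
    obtain w where w: "w \<in> Hom X t (Dom X k)" "k \<cdot> w = u" using kernel_lift[OF k u] .
    have "n \<cdot> (h \<cdot> w) = u" using Comp_assoc[OF w(1) h(1) n'(1)] h(2) w(2) by simp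
    moreover have "h \<cdot> w \<in> Hom X t (Dom X n)" using Comp_Hom[OF w(1) h(1)] .
    ultimately show ?thesis using mono_cancel[OF n'(2,1)] by blast
  qed
  ultimately show ?thesis
    using n'(1) unfolding is_kernel_iff[OF k(2)] by blast
qed

lemma kernel_class_eq:
  assumes "is_kernel X f k" "f \<in> Hom X a b"
  shows "kernel_class X f = {n \<in> monos_into X a. mono_le X k n \<and> mono_le X n k}"
  using kernel_if_equiv[OF assms] kernel_monos_into[OF _ assms(2)]
    kernel_mono_le_iff[OF _ assms(2) _ assms(2)] assms(1) kernel_le_refl
  by (auto simp: kernel_class_def)

end

section \<open>Subobjects of an abelian category as kernel classes\<close>

context abelian_category
begin

lemma kernel_exists: assumes "f \<in> Hom X a b" obtains k where "is_kernel X f k"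
  using kernels assms by (auto simp: Hom_iff)

lemma cokernel_exists: assumes "f \<in> Hom X a b" obtains q where "is_cokernel X f q"
  using cokernels assms by (auto simp: Hom_iff)

lemma kernel_class_subobject:
  assumes "f \<in> Hom X a b" shows "kernel_class X f \<in> subobjects X a"
proof -
  obtain k where k: "is_kernel X f k" using kernel_exists[OF assms] .
  show ?thesis
    using kernel_class_eq[OF k assms] subobjectsI[OF kernel_monos_into[OF k assms]] by simp
qed

text \<open>Normality makes \<open>m\<close> the kernel of some \<open>f\<close>. As
  \<open>f\<close> annihilates \<open>m\<close>, it factors through the cokernel \<open>q\<close>,
  so whatever \<open>q\<close> annihilates is annihilated by \<open>f\<close> and hence factors
  through \<open>m\<close>.\<close>

lemma mono_kernel_of_cokernel:
  assumes m: "mono_arr X m" "m \<in> Hom X a b" and q: "is_cokernel X m q"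
  shows "is_kernel X q m"
proof -
  note q' = cokernel_Hom[OF q m(2)]
  obtain f where f: "is_kernel X f m" using mono_normal[OF m(1)] by blast
  have f1: "f \<in> Hom X b (Cod X f)"
    using f HomD(3)[OF m(2)] unfolding is_kernel_def by (metis Hom_iff)
  have "f \<cdot> m = Zero X a (Cod X f)" using kernel_Hom(2)[OF f f1] m(2) by (simp add: Hom_iff)
  then obtain g where g: "g \<in> Hom X (Cod X q) (Cod X f)" "g \<cdot> q = f"
    using cokernel_desc[OF q m(2) f1] by blast
  have "\<exists>!w. w \<in> Hom X t a \<and> m \<cdot> w = u" if u: "u \<in> Hom X t b" "q \<cdot> u = Zero X t (Cod X q)" for t u
  proof -
    have "f \<cdot> u = Zero X t (Cod X f)"
      using Comp_assoc[OF u(1) q'(1) g(1)] g(2) u(2) Comp_Zero[OF g(1)] Hom_Obj(1)[OF u(1)] by simp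
    then obtain w where "w \<in> Hom X t (Dom X m)" "m \<cdot> w = u" using kernel_lift[OF f f1 u(1)] by blast
    moreover have "Dom X m = a" using m(2) by (simp add: Hom_iff)
    ultimately show ?thesis using mono_cancel[OF m] by blast
  qed
  then show ?thesis
    using m(2) q'(2) unfolding is_kernel_iff[OF q'(1)] HomD(2)[OF m(2)] by blast
qed

lemma epi_cokernel_of_kernel:
  assumes e: "epi_arr X e" "e \<in> Hom X a b" and k: "is_kernel X e k"
  shows "is_cokernel X k e"
proof -
  note k' = kernel_Hom[OF k e(2)]
  obtain f where f: "is_cokernel X f e" using epi_normal[OF e(1)] by blast
  have f1: "f \<in> Hom X (Dom X f) a"
    using f HomD(2)[OF e(2)] unfolding is_cokernel_def by (metis Hom_iff)
  have "e \<cdot> f = Zero X (Dom X f) b" using cokernel_Hom(2)[OF f f1] e(2) by (simp add: Hom_iff)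
  then obtain g where g: "g \<in> Hom X (Dom X f) (Dom X k)" "k \<cdot> g = f"
    using kernel_lift[OF k e(2) f1] by blast
  have "\<exists>!w. w \<in> Hom X b t \<and> w \<cdot> e = u" if u: "u \<in> Hom X a t" "u \<cdot> k = Zero X (Dom X k) t" for t u
  proof -
    have "u \<cdot> f = Zero X (Dom X f) t"
      using Comp_assoc[OF g(1) k'(1) u(1)] g(2) u(2) Zero_Comp[OF g(1)] Hom_Obj(2)[OF u(1)] by simp
    then obtain w where "w \<in> Hom X (Cod X e) t" "w \<cdot> e = u" using cokernel_desc[OF f f1 u(1)] by blast
    moreover have "Cod X e = b" using e(2) by (simp add: Hom_iff)
    ultimately show ?thesis using epi_cancel[OF e] by blast
  qed
  then show ?thesis
    using e(2) k'(2) unfolding is_cokernel_iff[OF k'(1)] HomD(3)[OF e(2)] by blast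
qed

text \<open>An epimorphism is the cokernel of its own kernel, so a morphism that annihilates this
  kernel descends. It plays the role of the homomorphism theorem.\<close>

lemma epi_factor:
  assumes "epi_arr X e" "e \<in> Hom X a b" "g \<in> Hom X a c" "kernel_le X e g"
  obtains h where "h \<in> Hom X b c" "h \<cdot> e = g"
proof -
  obtain k where k: "is_kernel X e k" using kernel_exists[OF assms(2)] .
  have "g \<cdot> k = Zero X (Dom X k) c" using kernel_le_iff[OF k assms(2,3)] assms(4) by simp
  then obtain h where "h \<in> Hom X (Cod X e) c" "h \<cdot> e = g"
    using cokernel_desc[OF epi_cokernel_of_kernel[OF assms(1,2) k] kernel_Hom(1)[OF k assms(2)] assms(3)]
    by blast
  then show thesis using that assms(2) by (auto simp: Hom_iff)
qed

text \<open>The cokernel \<open>q\<close> of a representative \<open>m\<close> has \<open>m\<close>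
  as its kernel, so the codomain of \<open>q\<close> is also the quotient by the subobject.\<close>

lemma subobject_kernel_class:
  assumes "I \<in> subobjects X a"
  obtains M q where "q \<in> Hom X a M" "epi_arr X q" "I = kernel_class X q"
proof -
  obtain m where m: "m \<in> monos_into X a" "I = {n \<in> monos_into X a. mono_le X m n \<and> mono_le X n m}"
    using subobjectsE[OF assms] .
  then have m': "mono_arr X m" "m \<in> Hom X (Dom X m) a" by (auto simp: monos_into_def mono_arr_def Hom_iff)
  obtain q where q: "is_cokernel X m q" using cokernel_exists[OF m'(2)] .
  note q1 = cokernel_Hom(1)[OF q m'(2)]
  have "kernel_class X q = I"
    using kernel_class_eq[OF mono_kernel_of_cokernel[OF m' q] q1] m(2) by simp
  then show thesis using that q1 cokernel_epi[OF q] by blast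
qed

lemma sub_le_kernel_class:
  assumes "f \<in> Hom X a b" "g \<in> Hom X a c"
  shows "sub_le X (kernel_class X f) (kernel_class X g) \<longleftrightarrow> kernel_le X f g"
proof -
  obtain k l where "is_kernel X f k" "is_kernel X g l" using kernel_exists assms by metis
  then show ?thesis
    unfolding sub_le_def kernel_class_def using kernel_mono_le_iff[OF _ assms(1) _ assms(2)] by blast
qed

lemma kernel_class_eq_iff:
  assumes "f \<in> Hom X a b" "g \<in> Hom X a c"
  shows "kernel_class X f = kernel_class X g \<longleftrightarrow> kernel_le X f g \<and> kernel_le X g f"
proof
  assume "kernel_class X f = kernel_class X g"
  then show "kernel_le X f g \<and> kernel_le X g f"
    using sub_le_kernel_class[OF assms] sub_le_kernel_class[OF assms(2,1)]
      sub_le_kernel_class[OF assms(1,1)] kernel_le_refl by metis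
next
  assume le: "kernel_le X f g \<and> kernel_le X g f"
  obtain k l where k: "is_kernel X f k" "is_kernel X g l" using kernel_exists assms by metis
  then have "mono_le X k l" "mono_le X l k"
    using le kernel_mono_le_iff[OF k(1) assms(1) k(2) assms(2)]
      kernel_mono_le_iff[OF k(2) assms(2) k(1) assms(1)] by auto
  then show "kernel_class X f = kernel_class X g"
    unfolding kernel_class_eq[OF k(1) assms(1)] kernel_class_eq[OF k(2) assms(2)]
    using mono_le_trans monos_into_Hom kernel_Hom(1)[OF k(1) assms(1)] kernel_Hom(1)[OF k(2) assms(2)]
    by blast
qed

text \<open>Here \<open>h\<close> stands for any morphism that annihilates exactly what both
  \<open>f\<close> and \<open>g\<close> annihilate; \<open>pairing\<close> later supplies
  one.\<close>

lemma sub_inter_kernel_class: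
  assumes f: "f \<in> Hom X a b" and g: "g \<in> Hom X a c" and h: "h \<in> Hom X a d"
    and le: "kernel_le X h f" "kernel_le X h g"
    and glb: "\<And>t u. \<lbrakk>u \<in> Hom X t a; f \<cdot> u = Zero X t b; g \<cdot> u = Zero X t c\<rbrakk> \<Longrightarrow> h \<cdot> u = Zero X t d"
  shows "sub_inter X a (kernel_class X f) (kernel_class X g) = kernel_class X h"
proof -
  obtain k l n where k: "is_kernel X f k" and l: "is_kernel X g l" and n: "is_kernel X h n"
    using kernel_exists f g h by metis
  \<comment> \<open>All members of the class are kernels of \<open>f'\<close>, so lying below one of
    them amounts to being annihilated by \<open>f'\<close>.\<close>
  have le_iff: "(\<exists>i \<in> kernel_class X f'. mono_le X m i) \<longleftrightarrow> f' \<cdot> m = Zero X (Dom X m) b'"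
    if f': "f' \<in> Hom X a b'" and m: "m \<in> monos_into X a" for f' b' m
  proof -
    have m': "mono_arr X m" "m \<in> Hom X (Dom X m) a"
      using m by (auto simp: monos_into_def mono_arr_def Hom_iff)
    obtain k where k: "is_kernel X f' k" using kernel_exists[OF f'] .
    show ?thesis
    proof
      assume "\<exists>i \<in> kernel_class X f'. mono_le X m i"
      then obtain i w where i: "is_kernel X f' i" and w: "w \<in> Hom X (Dom X m) (Dom X i)" "m = i \<cdot> w"
        by (auto simp: kernel_class_def mono_le_def)
      then show "f' \<cdot> m = Zero X (Dom X m) b'"
        using Comp_assoc[OF w(1) kernel_Hom(1)[OF i f'] f'] kernel_Hom(2)[OF i f'] Zero_Comp[OF w(1)]
          Hom_Obj(2)[OF f'] by simp
    next
      assume "f' \<cdot> m = Zero X (Dom X m) b'"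
      then show "\<exists>i \<in> kernel_class X f'. mono_le X m i"
        using kernel_lift[OF k f' m'(2)] k by (metis kernel_class_def mem_Collect_eq mono_le_def)
    qed
  qed
  have key: "(\<exists>i \<in> kernel_class X f. mono_le X m i) \<and> (\<exists>j \<in> kernel_class X g. mono_le X m j)
     \<longleftrightarrow> mono_le X m n" if m: "m \<in> monos_into X a" for m
  proof -
    have m': "m \<in> Hom X (Dom X m) a"
      using m by (auto simp: monos_into_def mono_arr_def Hom_iff)
    have "mono_le X m n \<longleftrightarrow> (\<exists>i \<in> kernel_class X h. mono_le X m i)"
      using n kernel_mono_le_iff[OF _ h n h] kernel_le_refl mono_le_trans kernel_Hom(1)[OF n h]
      unfolding kernel_class_def by blast
    then show ?thesis
      using le_iff[OF f m] le_iff[OF g m] le_iff[OF h m] glb[OF m'] kernel_leD[OF le(1) h f m']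
        kernel_leD[OF le(2) h g m'] by blast
  qed
  note nm = kernel_monos_into[OF n h]
  \<comment> \<open>By \<open>key\<close> the common lower bounds are the monomorphisms below
    \<open>n\<close>; the greatest among them are those equivalent to \<open>n\<close>.\<close>
  have "m \<in> sub_inter X a (kernel_class X f) (kernel_class X g) \<longleftrightarrow>
    m \<in> monos_into X a \<and> mono_le X m n \<and> mono_le X n m" for m
  proof -
    have "m \<in> sub_inter X a (kernel_class X f) (kernel_class X g) \<longleftrightarrow>
      m \<in> monos_into X a \<and> mono_le X m n \<and> (\<forall>l \<in> monos_into X a. mono_le X l n \<longrightarrow> mono_le X l m)"
      unfolding sub_inter_def mem_Collect_eq using key by blast
    also have "\<dots> \<longleftrightarrow> m \<in> monos_into X a \<and> mono_le X m n \<and> mono_le X n m"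
      using nm mono_le_refl[OF kernel_Hom(1)[OF n h]] mono_le_trans monos_into_Hom by blast
    finally show ?thesis .
  qed
  then show ?thesis
    unfolding kernel_class_eq[OF n h] by blast
qed

text \<open>Pulling back a kernel of \<open>g\<close> along \<open>f\<close> gives a kernel of g
  \<cdot> f. Since \<open>sub_preimage\<close> collects all representatives, it is also needed that
  each kernel of g \<cdot> f is the projection of such a pullback.\<close>

lemma sub_preimage_kernel_class:
  assumes f: "f \<in> Hom X a b" and g: "g \<in> Hom X b c"
  shows "sub_preimage X f (kernel_class X g) = kernel_class X (g \<cdot> f)"
proof -
  note gf = Comp_Hom[OF f g]
  have cO: "c \<in> Obj X" using Hom_Obj g by blast
  have *: "is_kernel X (g \<cdot> f) m"
    if j: "is_kernel X g j" and pb: "is_pullback X f j m h" for m j h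
  proof -
    note j' = kernel_Hom[OF j g]
    note pb' = pb[unfolded is_pullback_iff[OF f j'(1)]]
    have m: "m \<in> Hom X (Dom X m) a" and h: "h \<in> Hom X (Dom X m) (Dom X j)" and eq: "f \<cdot> m = j \<cdot> h"
      using pb' by simp_all
    have univ: "\<exists>!w. w \<in> Hom X t (Dom X m) \<and> m \<cdot> w = u \<and> h \<cdot> w = v"
      if "u \<in> Hom X t a" "v \<in> Hom X t (Dom X j)" "f \<cdot> u = j \<cdot> v" for t u v
      using conjunct2[OF conjunct2[OF conjunct2[OF pb']], rule_format, OF that] .
    have "(g \<cdot> f) \<cdot> m = Zero X (Dom X m) c"
      using Comp_assoc[OF m f g] eq Comp_assoc[OF h j'(1) g] j'(2) Zero_Comp[OF h cO] by simp
    moreover have "\<exists>!w. w \<in> Hom X t (Dom X m) \<and> m \<cdot> w = u"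
      if u: "u \<in> Hom X t a" "(g \<cdot> f) \<cdot> u = Zero X t c" for t u
    proof -
      have fu: "f \<cdot> u \<in> Hom X t b" using Comp_Hom[OF u(1) f] .
      have "g \<cdot> (f \<cdot> u) = Zero X t c" using Comp_assoc[OF u(1) f g] u(2) by simp
      then obtain v where v: "v \<in> Hom X t (Dom X j)" "j \<cdot> v = f \<cdot> u" using kernel_lift[OF j g fu] by blast
      note ex1 = univ[OF u(1) v(1) v(2)[symmetric]]
      obtain w where w: "w \<in> Hom X t (Dom X m)" "m \<cdot> w = u" "h \<cdot> w = v"
        using ex1_implies_ex[OF ex1] by blast
      have uniq: "w' = w" if w': "w' \<in> Hom X t (Dom X m)" "m \<cdot> w' = u" for w'
      proof -
        \<comment> \<open>The universal property of the pullback gives uniqueness only for pairs. As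
          \<open>j\<close> is a monomorphism, the second component of \<open>w'\<close> is
          determined by the first.\<close>
        have "j \<cdot> (h \<cdot> w') = j \<cdot> v"
          using Comp_assoc[OF w'(1) h j'(1)] Comp_assoc[OF w'(1) m f] eq w'(2) v(2) by simp
        then have hw': "h \<cdot> w' = v" by (rule mono_cancel[OF kernel_mono[OF j] j'(1) Comp_Hom[OF w'(1) h] v(1)])
        show "w' = w" by (rule ex1_unique[OF ex1], intro conjI w' hw', intro conjI w)
      qed
      show ?thesis by (rule ex1I[of _ w], intro conjI w, elim conjE, rule uniq)
    qed
    ultimately show ?thesis using m unfolding is_kernel_iff[OF gf] by blast
  qed
  have **: "\<exists>h. is_pullback X f j m h" if m: "is_kernel X (g \<cdot> f) m" and j: "is_kernel X g j" for m j
  proof -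
    note j' = kernel_Hom[OF j g] and m' = kernel_Hom[OF m gf]
    note fm = Comp_Hom[OF m'(1) f]
    have "g \<cdot> (f \<cdot> m) = Zero X (Dom X m) c" using Comp_assoc[OF m'(1) f g] m'(2) by simp
    then obtain h where h: "h \<in> Hom X (Dom X m) (Dom X j)" "j \<cdot> h = f \<cdot> m" using kernel_lift[OF j g fm] by blast
    have "\<exists>!w. w \<in> Hom X t (Dom X m) \<and> m \<cdot> w = u \<and> h \<cdot> w = v"
      if u: "u \<in> Hom X t a" and v: "v \<in> Hom X t (Dom X j)" and eq: "f \<cdot> u = j \<cdot> v" for t u v
    proof -
      have "(g \<cdot> f) \<cdot> u = Zero X t c"
        using Comp_assoc[OF u f g] eq Comp_assoc[OF v j'(1) g] j'(2) Zero_Comp[OF v cO] by simp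
      then obtain w where w: "w \<in> Hom X t (Dom X m)" "m \<cdot> w = u" using kernel_lift[OF m gf u] by blast
      have "j \<cdot> (h \<cdot> w) = j \<cdot> v"
        using Comp_assoc[OF w(1) h(1) j'(1)] Comp_assoc[OF w(1) m'(1) f] eq w(2) h(2) by simp
      then have "h \<cdot> w = v" using mono_cancel[OF kernel_mono[OF j] j'(1) Comp_Hom[OF w(1) h(1)] v] by simp
      then show ?thesis using w mono_cancel[OF kernel_mono[OF m] m'(1)] by blast
    qed
    then have "is_pullback X f j m h"
      using m'(1) h unfolding is_pullback_iff[OF f j'(1)] by auto
    then show ?thesis ..
  qed
  obtain j where j: "is_kernel X g j" using kernel_exists[OF g] .
  show ?thesis
  proof (intro equalityI subsetI)
    fix m assume "m \<in> sub_preimage X f (kernel_class X g)"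
    then show "m \<in> kernel_class X (g \<cdot> f)"
      unfolding sub_preimage_def kernel_class_def using * by blast
  next
    fix m assume "m \<in> kernel_class X (g \<cdot> f)"
    then have m: "is_kernel X (g \<cdot> f) m" by (simp add: kernel_class_def)
    show "m \<in> sub_preimage X f (kernel_class X g)"
      unfolding sub_preimage_def kernel_class_def HomD(2)[OF f]
      using **[OF m j] j kernel_monos_into[OF m gf] by blast
  qed
qed

text \<open>The identity is a kernel of any zero morphism. The target \<open>b\<close> is left free
  so that it can later be taken inside a given subcategory.\<close>

lemma top_kernel_class:
  assumes "a \<in> Obj X" "b \<in> Obj X"
  shows "{m \<in> monos_into X a. mono_le X (Ident X a) m} = kernel_class X (Zero X a b)"
proof -
  note i = Ident_Hom[OF assms(1)] and z = Zero_Hom[OF assms]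
  have k: "is_kernel X (Zero X a b) (Ident X a)"
    using i Zero_Comp[OF i assms(2)] Ident_left
    unfolding is_kernel_iff[OF z] HomD(2)[OF i] by metis
  have "mono_le X m (Ident X a)" if "m \<in> monos_into X a" for m
  proof -
    have "m \<in> Hom X (Dom X m) a" using that by (auto simp: monos_into_def mono_arr_def Hom_iff)
    then show ?thesis using Ident_left[of m "Dom X m" a] HomD(2)[OF i] unfolding mono_le_def by metis
  qed
  then show ?thesis using kernel_class_eq[OF k z] by auto
qed

text \<open>A cokernel of a monomorphism has that monomorphism as its kernel, and an epimorphism is
  the cokernel of its kernel. So quotients can be handled as epimorphisms with a prescribed
  kernel.\<close>

lemma is_quotient_kernel_class:
  assumes "f \<in> Hom X a b"
  shows "is_quotient X (kernel_class X f) Q \<longleftrightarrow>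
    (\<exists>q \<in> Hom X a Q. epi_arr X q \<and> kernel_class X q = kernel_class X f)"
proof
  assume "is_quotient X (kernel_class X f) Q"
  then obtain m q where m: "is_kernel X f m" and q: "is_cokernel X m q" "Cod X q = Q"
    by (auto simp: is_quotient_def kernel_class_def)
  note m' = kernel_Hom[OF m assms] and mm = kernel_mono[OF m]
  note q' = cokernel_Hom[OF q(1) m'(1)]
  have "is_kernel X q m" using mono_kernel_of_cokernel[OF mm m'(1) q(1)] .
  then have "kernel_class X q = kernel_class X f"
    using kernel_class_eq[OF _ q'(1), of m] kernel_class_eq[OF m assms] by simp
  then show "\<exists>q \<in> Hom X a Q. epi_arr X q \<and> kernel_class X q = kernel_class X f"
    using q' q cokernel_epi by blast
next
  assume "\<exists>q \<in> Hom X a Q. epi_arr X q \<and> kernel_class X q = kernel_class X f"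
  then obtain q where q: "q \<in> Hom X a Q" "epi_arr X q" "kernel_class X q = kernel_class X f" by blast
  obtain m where m: "is_kernel X q m" using kernel_exists[OF q(1)] .
  then show "is_quotient X (kernel_class X f) Q"
    using epi_cokernel_of_kernel[OF q(2,1) m] q unfolding is_quotient_def kernel_class_def
    by (auto simp: Hom_iff)
qed

end

section \<open>Finite sums of morphisms and closure properties of filters\<close>

context preadditive_category
begin

lemma finprod_Comp_Zero:
  assumes "finite J" "a \<in> Obj X" "b \<in> Obj X" "u \<in> Hom X t a"
    and "\<And>i. i \<in> J \<Longrightarrow> f i \<in> Hom X a b" "\<And>i. i \<in> J \<Longrightarrow> f i \<cdot> u = Zero X t b"
  shows "finprod (Hom_group X a b) f J \<cdot> u = Zero X t b"
  using assms(1,5,6)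
proof (induction J)
  case empty
  interpret comm_group "Hom_group X a b" using Hom_comm_group[OF assms(2,3)] .
  have "finprod (Hom_group X a b) f {} = Zero X a b"
    unfolding finprod_empty by (simp add: Hom_group_def)
  then show ?case using Zero_Comp[OF assms(4,3)] by simp
next
  case (insert i J)
  interpret comm_group "Hom_group X a b" using Hom_comm_group[OF assms(2,3)] .
  have f: "f \<in> J \<rightarrow> carrier (Hom_group X a b)" "f i \<in> carrier (Hom_group X a b)"
    using insert.prems(1) by (auto simp: Hom_group_def)
  have g: "finprod (Hom_group X a b) f J \<in> Hom X a b"
    using finprod_closed[OF f(1)] by (simp add: Hom_group_def)
  have fi: "f i \<in> Hom X a b" using insert.prems(1) by simp
  have "finprod (Hom_group X a b) f (insert i J) = Plus X (f i) (finprod (Hom_group X a b) f J)"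
    using finprod_insert[OF insert.hyps f] by (simp add: Hom_group_def)
  also have "\<dots> \<cdot> u = Plus X (f i \<cdot> u) (finprod (Hom_group X a b) f J \<cdot> u)"
    using Comp_Plus_left[OF assms(4) fi g] .
  also have "\<dots> = Plus X (Zero X t b) (Zero X t b)"
    using insert.IH insert.prems by simp
  also have "\<dots> = Zero X t b"
    using Plus_Zero(1)[OF Zero_Hom[OF Hom_Obj(1)[OF assms(4)] assms(3)]] .
  finally show ?case .
qed

end

context abelian_category
begin

lemma sub_filter_up:
  assumes "sub_filter X a F" "f \<in> Hom X a b" "kernel_class X f \<in> F" "g \<in> Hom X a c" "kernel_le X f g"
  shows "kernel_class X g \<in> F"
  using assms sub_le_kernel_class[OF assms(2,4)] kernel_class_subobject[OF assms(4)]
  unfolding sub_filter_def by blast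

lemma sub_filter_top:
  assumes "sub_filter X a F" "a \<in> Obj X" "b \<in> Obj X"
  shows "kernel_class X (Zero X a b) \<in> F"
  using assms top_kernel_class[OF assms(2,3)] unfolding sub_filter_def by simp

lemma sub_filter_inter:
  assumes "sub_filter X a F" "kernel_class X f \<in> F" "kernel_class X g \<in> F"
    and "f \<in> Hom X a b" "g \<in> Hom X a c" "h \<in> Hom X a d" "kernel_le X h f" "kernel_le X h g"
    and "\<And>t u. \<lbrakk>u \<in> Hom X t a; f \<cdot> u = Zero X t b; g \<cdot> u = Zero X t c\<rbrakk> \<Longrightarrow> h \<cdot> u = Zero X t d"
  shows "kernel_class X h \<in> F"
proof -
  have "sub_inter X a (kernel_class X f) (kernel_class X g) \<in> F"
    using assms(1-3) unfolding sub_filter_def by blast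
  moreover have "sub_inter X a (kernel_class X f) (kernel_class X g) = kernel_class X h"
    using assms(9) by (rule sub_inter_kernel_class[OF assms(4-8)])
  ultimately show ?thesis by simp
qed

end

section \<open>Small sets and pairings\<close>

context grothendieck_category
begin

lemma Cinfinite_\<kappa>: "Cinfinite \<kappa>" and regularCard_\<kappa>: "regularCard \<kappa>"
  using inaccessible by (auto simp: inaccessible_def)

lemma small_subset: "\<lbrakk>|T| <o \<kappa>; S \<subseteq> T\<rbrakk> \<Longrightarrow> |S| <o \<kappa>"
  using card_of_mono1 ordLeq_ordLess_trans by blast

lemma small_image: "|S| <o \<kappa> \<Longrightarrow> |f ` S| <o \<kappa>"
  using card_of_image ordLeq_ordLess_trans by blast

lemma small_finite: assumes "finite S" shows "|S| <o \<kappa>"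
  using assms finite_iff_ordLess_natLeq natLeq_ordLeq_cinfinite[OF Cinfinite_\<kappa>] ordLess_ordLeq_trans
  by blast

lemma small_UN: "\<lbrakk>|S| <o \<kappa>; \<And>s. s \<in> S \<Longrightarrow> |F s| <o \<kappa>\<rbrakk> \<Longrightarrow> |\<Union>s\<in>S. F s| <o \<kappa>"
  using card_of_UNION_ordLess_infinite_Field_regularCard[OF regularCard_\<kappa> Cinfinite_\<kappa>] by blast

text \<open>A set smaller than \<kappa> injects into \<open>Field \<kappa>\<close>, so its image
  there can serve as an index set of type \<open>'u\<close>, with the inverse map as
  enumeration.\<close>

lemma small_reindex:
  assumes "|S| <o \<kappa>"
  obtains I :: "'u set" and \<phi> where "|I| <o \<kappa>" "\<phi> ` I = S"
proof -
  have "|S| \<le>o |Field \<kappa>|"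
    using assms ordLess_imp_ordLeq card_of_Field_ordIso[OF conjunct2[OF Cinfinite_\<kappa>]]
      ordIso_symmetric ordLeq_ordIso_trans by blast
  then obtain f where f: "inj_on f S" "f ` S \<subseteq> Field \<kappa>" unfolding card_of_ordLeq[symmetric] by blast
  show ?thesis
  proof (rule that)
    show "|f ` S| <o \<kappa>" using small_image[OF assms] .
    show "inv_into S f ` f ` S = S" using f(1) by simp
  qed
qed

text \<open>Inaccessibility speaks of sets of type \<open>'u\<close> only. A surjection from such a
  set carries the bound over, because it induces a surjection of power sets.\<close>

lemma small_Pow: assumes "|S| <o \<kappa>" shows "|Pow S| <o \<kappa>"
proof -
  obtain I :: "'u set" and \<phi> where I: "|I| <o \<kappa>" "\<phi> ` I = S" using small_reindex[OF assms] .
  have "|Pow I| <o \<kappa>" using inaccessible I(1) by (simp add: inaccessible_def)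
  then have "|image \<phi> ` Pow I| <o \<kappa>" by (rule small_image)
  then show ?thesis using image_Pow_surj[OF I(2)] by simp
qed

lemma small_Times: assumes "|S| <o \<kappa>" "|T| <o \<kappa>" shows "|S \<times> T| <o \<kappa>"
proof -
  have "S \<times> T = (\<Union>s\<in>S. Pair s ` T)" by auto
  then show ?thesis using small_UN[OF assms(1) small_image[OF assms(2)]] by simp
qed

text \<open>A function in \<open>Pi\<^sub>E I F\<close> is recovered by \<open>?g\<close> from its
  graph, a subset of a small product set; off \<open>I\<close> its value is
  \<open>undefined\<close>.\<close>

lemma small_PiE:
  assumes "|I| <o \<kappa>" "\<And>i. i \<in> I \<Longrightarrow> |F i| <o \<kappa>"
  shows "|Pi\<^sub>E I F| <o \<kappa>"
proof -
  let ?g = "\<lambda>R i. if i \<in> I then THE y. (i, y) \<in> R else undefined"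
  have "f \<in> ?g ` Pow (I \<times> (\<Union>i\<in>I. F i))" if "f \<in> Pi\<^sub>E I F" for f
  proof (rule image_eqI)
    show "f = ?g {(i, f i) | i. i \<in> I}" using that by (auto simp: fun_eq_iff PiE_def extensional_def)
    show "{(i, f i) | i. i \<in> I} \<in> Pow (I \<times> (\<Union>i\<in>I. F i))" using that by auto
  qed
  then have "Pi\<^sub>E I F \<subseteq> ?g ` Pow (I \<times> (\<Union>i\<in>I. F i))" by blast
  moreover have "|?g ` Pow (I \<times> (\<Union>i\<in>I. F i))| <o \<kappa>"
    by (intro small_image small_Pow small_Times small_UN assms)
  ultimately show ?thesis by (rule small_subset[rotated])
qed

text \<open>The codomain of the pairing is a coproduct indexed by a subset of \<^typ>\<open>'u\<close>, as in
  the definition of a weakly closed subcategory.\<close>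

lemma pairing:
  assumes f: "f \<in> Hom X a b" and g: "g \<in> Hom X a c"
  obtains I :: "'u set" and N P \<iota> h where "|I| <o \<kappa>" "\<forall>i\<in>I. N i \<in> {b, c}"
    "is_coproduct X I N P \<iota>" "h \<in> Hom X a P" "kernel_le X h f" "kernel_le X h g"
    "\<forall>t. \<forall>u \<in> Hom X t a. f \<cdot> u = Zero X t b \<and> g \<cdot> u = Zero X t c \<longrightarrow> h \<cdot> u = Zero X t P"
proof -
  have "infinite (Field \<kappa>)" using Cinfinite_\<kappa> by (simp add: cinfinite_def)
  \<comment> \<open>As \<open>b\<close> and \<open>c\<close> may be the same object, the two
    summands are told apart by distinct indices, which exist because \<kappa> is infinite.\<close>
  then obtain i j :: 'u where ij: "i \<noteq> j"
    by (metis finite.simps finite_subset insertI1 subsetI singletonI)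
  let ?I = "{i, j}" and ?N = "\<lambda>k. if k = i then b else c"
  have small: "|?I| <o \<kappa>" by (rule small_finite) simp
  have O: "a \<in> Obj X" "b \<in> Obj X" "c \<in> Obj X" using Hom_Obj[OF f] Hom_Obj[OF g] by auto
  then have "\<forall>k\<in>?I. ?N k \<in> Obj X" by simp
  then obtain P \<iota> where P: "is_coproduct X ?I ?N P \<iota>" using coproducts[OF small, of ?N] by blast
  have inj: "\<iota> i \<in> Hom X b P" "\<iota> j \<in> Hom X c P"
    using coproduct_inj[OF P, of i] coproduct_inj[OF P, of j] ij by auto
  obtain p where p: "p \<in> Hom X P b" "\<And>k. k \<in> ?I \<Longrightarrow> p \<cdot> \<iota> k = (if k = i then Ident X b else Zero X c b)"
    by (rule coproduct_induced[OF P O(2), of "\<lambda>k. if k = i then Ident X b else Zero X c b"])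
      (use Ident_Hom Zero_Hom O in auto)
  obtain q where q: "q \<in> Hom X P c" "\<And>k. k \<in> ?I \<Longrightarrow> q \<cdot> \<iota> k = (if k = i then Zero X b c else Ident X c)"
    by (rule coproduct_induced[OF P O(3), of "\<lambda>k. if k = i then Zero X b c else Ident X c"])
      (use Ident_Hom Zero_Hom O in auto)
  \<comment> \<open>The pair (f, g) is the sum of its two components in the coproduct;
    \<open>p\<close> and \<open>q\<close> retract onto the summands and give \<open>f\<close> and
    \<open>g\<close> back.\<close>
  let ?f = "\<iota> i \<cdot> f" and ?g = "\<iota> j \<cdot> g"
  let ?h = "Plus X ?f ?g"
  have f': "?f \<in> Hom X a P" and g': "?g \<in> Hom X a P" using Comp_Hom f g inj by auto
  have h: "?h \<in> Hom X a P" by (rule Plus_Hom[OF f' g'])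
  have pi: "p \<cdot> \<iota> i = Ident X b" and pj: "p \<cdot> \<iota> j = Zero X c b"
    and qi: "q \<cdot> \<iota> i = Zero X b c" and qj: "q \<cdot> \<iota> j = Ident X c" using p(2) q(2) ij by auto
  have "p \<cdot> ?h = Plus X ((p \<cdot> \<iota> i) \<cdot> f) ((p \<cdot> \<iota> j) \<cdot> g)"
    unfolding Comp_Plus_right[OF f' g' p(1)] Comp_assoc[OF f inj(1) p(1)] Comp_assoc[OF g inj(2) p(1)] ..
  then have ph: "p \<cdot> ?h = f"
    unfolding pi pj using Ident_left[OF f] Zero_Comp[OF g O(2)] Plus_Zero(1)[OF f] by simp
  have "q \<cdot> ?h = Plus X ((q \<cdot> \<iota> i) \<cdot> f) ((q \<cdot> \<iota> j) \<cdot> g)"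
    unfolding Comp_Plus_right[OF f' g' q(1)] Comp_assoc[OF f inj(1) q(1)] Comp_assoc[OF g inj(2) q(1)] ..
  then have qh: "q \<cdot> ?h = g"
    unfolding qi qj using Ident_left[OF g] Zero_Comp[OF f O(3)] Plus_Zero(2)[OF g] by simp
  have comp: "kernel_le X ?h r" if "s \<in> Hom X P d" "s \<cdot> ?h = r" "r \<in> Hom X a d" for r s d
  proof (rule kernel_leI[OF h that(3)])
    fix t u assume u: "u \<in> Hom X t a" "?h \<cdot> u = Zero X t P"
    then show "r \<cdot> u = Zero X t d"
      using Comp_assoc[OF u(1) h that(1)] that(2) Comp_Zero[OF that(1) Hom_Obj(1)[OF u(1)]] by simp
  qed
  have glb: "?h \<cdot> u = Zero X t P"
    if u: "u \<in> Hom X t a" "f \<cdot> u = Zero X t b" "g \<cdot> u = Zero X t c" for t u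
  proof -
    have t: "t \<in> Obj X" using Hom_Obj(1)[OF u(1)] .
    have "?h \<cdot> u = Plus X (\<iota> i \<cdot> (f \<cdot> u)) (\<iota> j \<cdot> (g \<cdot> u))"
      unfolding Comp_Plus_left[OF u(1) f' g'] Comp_assoc[OF u(1) f inj(1)] Comp_assoc[OF u(1) g inj(2)] ..
    then show ?thesis
      unfolding u(2,3) Comp_Zero[OF inj(1) t] Comp_Zero[OF inj(2) t]
      using Plus_Zero(1)[OF Zero_Hom[OF t Hom_Obj(2)[OF h]]] by simp
  qed
  show thesis
    by (rule that[OF small _ P h comp[OF p(1) ph f] comp[OF q(1) qh g]]) (use glb in simp_all)
qed

text \<open>By induction a single \<open>h\<close> is found whose kernel lies in the filter and is
  contained in the kernels of all \<open>x i\<close>: the zero morphism for no index, then a pairing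
  at each step. The kernel of \<open>y\<close> is larger still.\<close>

lemma sub_filter_finite:
  assumes F: "sub_filter X a F" and a: "a \<in> Obj X"
    and J: "finite J" "\<And>i. i \<in> J \<Longrightarrow> x i \<in> Hom X a (N i)" "\<And>i. i \<in> J \<Longrightarrow> kernel_class X (x i) \<in> F"
    and y: "y \<in> Hom X a M"
    and le: "\<And>t u. \<lbrakk>u \<in> Hom X t a; \<And>i. i \<in> J \<Longrightarrow> x i \<cdot> u = Zero X t (N i)\<rbrakk> \<Longrightarrow> y \<cdot> u = Zero X t M"
  shows "kernel_class X y \<in> F"
proof -
  have "\<exists>b. \<exists>h \<in> Hom X a b. kernel_class X h \<in> F \<and> (\<forall>i\<in>J. kernel_le X h (x i))"
    using J
  proof (induction J)
    case empty
    show ?case using sub_filter_top[OF F a a] Zero_Hom[OF a a] by blast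
  next
    case (insert i J)
    then have "\<exists>b. \<exists>h \<in> Hom X a b. kernel_class X h \<in> F \<and> (\<forall>i\<in>J. kernel_le X h (x i))" by simp
    then obtain b h where h: "h \<in> Hom X a b" "kernel_class X h \<in> F" "\<forall>i\<in>J. kernel_le X h (x i)" by blast
    have xi: "x i \<in> Hom X a (N i)" "kernel_class X (x i) \<in> F" using insert.prems by auto
    obtain I :: "'u set" and N' P \<iota> r where "|I| <o \<kappa>" "\<forall>k\<in>I. N' k \<in> {b, N i}"
      "is_coproduct X I N' P \<iota>" and r: "r \<in> Hom X a P" "kernel_le X r h" "kernel_le X r (x i)"
      "\<forall>t. \<forall>u \<in> Hom X t a. h \<cdot> u = Zero X t b \<and> x i \<cdot> u = Zero X t (N i) \<longrightarrow> r \<cdot> u = Zero X t P"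
      by (rule pairing[OF h(1) xi(1)])
    have "kernel_class X r \<in> F"
      by (rule sub_filter_inter[OF F h(2) xi(2) h(1) xi(1) r(1-3)]) (use r(4) in blast)
    moreover have "kernel_le X r (x k)" if k: "k \<in> J" for k
    proof (rule kernel_leI[OF r(1)])
      show xk: "x k \<in> Hom X a (N k)" using insert.prems k by simp
      fix t u assume u: "u \<in> Hom X t a" "r \<cdot> u = Zero X t P"
      have hu: "h \<cdot> u = Zero X t b" using kernel_leD[OF r(2,1) h(1) u] .
      show "x k \<cdot> u = Zero X t (N k)"
        using kernel_leD[OF _ h(1) xk u(1) hu] h(3) k by blast
    qed
    ultimately show ?case using r(1,3) by blast
  qed
  then obtain b h where h: "h \<in> Hom X a b" "kernel_class X h \<in> F" "\<forall>i\<in>J. kernel_le X h (x i)" by blast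
  have "kernel_le X h y"
  proof (rule kernel_leI[OF h(1) y])
    fix t u assume u: "u \<in> Hom X t a" "h \<cdot> u = Zero X t b"
    show "y \<cdot> u = Zero X t M"
    proof (rule le[OF u(1)])
      fix i assume "i \<in> J"
      then show "x i \<cdot> u = Zero X t (N i)" using kernel_leD[OF _ h(1) J(2) u] h(3) by blast
    qed
  qed
  then show ?thesis by (rule sub_filter_up[OF F h(1,2) y])
qed

end

section \<open>Elements\<close>

locale compact_projective_generators = grothendieck_category \<kappa> X
  for \<kappa> :: "'u rel" and X :: "('o, 'm, 'z) ab_category_scheme" (structure) +
  fixes A :: "'a set" and G :: "'a \<Rightarrow> 'o"
  assumes small_A: "|A| <o \<kappa>"
    and generating: "is_generating_family X A G"
    and compact: "\<alpha> \<in> A \<Longrightarrow> compact_object \<kappa> X (G \<alpha>)"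
    and projective: "\<alpha> \<in> A \<Longrightarrow> projective_object X (G \<alpha>)"
begin

lemma G_Obj: "\<alpha> \<in> A \<Longrightarrow> G \<alpha> \<in> Obj X"
  using generating by (simp add: is_generating_family_def)

text \<open>Only the coproduct of the \<open>G \<alpha>\<close> is given as a generator. A test
  morphism out of it is determined by its restrictions to the summands, which are elements.\<close>

lemma generators_separate:
  assumes u: "u \<in> Hom X a b" "v \<in> Hom X a b"
    and eq: "\<And>\<alpha> x. \<lbrakk>\<alpha> \<in> A; x \<in> Hom X (G \<alpha>) a\<rbrakk> \<Longrightarrow> u \<cdot> x = v \<cdot> x"
  shows "u = v"
proof (rule ccontr)
  assume "u \<noteq> v"
  obtain P \<iota> where P: "is_coproduct X A G P \<iota>" "is_generator X P"
    using generating by (auto simp: is_generating_family_def)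
  obtain h where h: "h \<in> Hom X P a" "u \<cdot> h \<noteq> v \<cdot> h"
    using P(2) u \<open>u \<noteq> v\<close> unfolding is_generator_def by blast
  have "u \<cdot> h = v \<cdot> h"
  proof (rule coproduct_eqI[OF P(1) Comp_Hom[OF h(1) u(1)] Comp_Hom[OF h(1) u(2)]])
    fix \<alpha> assume \<alpha>: "\<alpha> \<in> A"
    have i: "\<iota> \<alpha> \<in> Hom X (G \<alpha>) P" using coproduct_inj[OF P(1) \<alpha>] .
    show "u \<cdot> h \<cdot> \<iota> \<alpha> = v \<cdot> h \<cdot> \<iota> \<alpha>"
      unfolding Comp_assoc[OF i h(1) u(1)] Comp_assoc[OF i h(1) u(2)]
      by (rule eq[OF \<alpha> Comp_Hom[OF i h(1)]])
  qed
  then show False using h(2) by simp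
qed

lemma zero_if_elements:
  assumes u: "u \<in> Hom X a b"
    and z: "\<And>\<alpha> x. \<lbrakk>\<alpha> \<in> A; x \<in> Hom X (G \<alpha>) a\<rbrakk> \<Longrightarrow> u \<cdot> x = Zero X (G \<alpha>) b"
  shows "u = Zero X a b"
proof (rule generators_separate[OF u Zero_Hom[OF Hom_Obj[OF u]]])
  fix \<alpha> x assume \<alpha>: "\<alpha> \<in> A" and x: "x \<in> Hom X (G \<alpha>) a"
  then show "u \<cdot> x = Zero X a b \<cdot> x" using z[OF \<alpha> x] Zero_Comp[OF x Hom_Obj(2)[OF u]] by simp
qed

text \<open>Additivity reduces injectivity to a trivial kernel: the difference \<open>d\<close> of
  two morphisms with equal composites is annihilated by \<open>m\<close>, and \<open>d\<close>
  vanishes because all its composites with elements do.\<close>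

lemma mono_if_elements:
  assumes m: "m \<in> Hom X a b"
    and z: "\<And>\<alpha> x. \<lbrakk>\<alpha> \<in> A; x \<in> Hom X (G \<alpha>) a; m \<cdot> x = Zero X (G \<alpha>) b\<rbrakk> \<Longrightarrow> x = Zero X (G \<alpha>) a"
  shows "mono_arr X m"
proof (rule mono_arrI[OF m])
  fix t u v assume u: "u \<in> Hom X t a" and v: "v \<in> Hom X t a" and eq: "m \<cdot> u = m \<cdot> v"
  obtain d where d: "d \<in> Hom X t a" "u = Plus X v d" using difference[OF u v] .
  have md: "m \<cdot> d \<in> Hom X t b" and mv: "m \<cdot> v \<in> Hom X t b" using Comp_Hom m d(1) v by auto
  have "Plus X (m \<cdot> v) (m \<cdot> d) = m \<cdot> v"
    using Comp_Plus_right[OF v d(1) m] d(2) eq by simp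
  then have 0: "m \<cdot> d = Zero X t b" by (rule Plus_left_cancel[OF mv md])
  have "d = Zero X t a"
  proof (rule zero_if_elements[OF d(1)])
    fix \<alpha> x assume \<alpha>: "\<alpha> \<in> A" and x: "x \<in> Hom X (G \<alpha>) t"
    have "m \<cdot> (d \<cdot> x) = Zero X (G \<alpha>) b"
      using Comp_assoc[OF x d(1) m] 0 Zero_Comp[OF x Hom_Obj(2)[OF m]] by simp
    then show "d \<cdot> x = Zero X (G \<alpha>) a" by (rule z[OF \<alpha> Comp_Hom[OF x d(1)]])
  qed
  then show "u = v" using d(2) Plus_Zero(1)[OF v] by simp
qed

lemma epi_lift:
  assumes "epi_arr X e" "e \<in> Hom X a b" "\<alpha> \<in> A" "y \<in> Hom X (G \<alpha>) b"
  obtains x where "x \<in> Hom X (G \<alpha>) a" "e \<cdot> x = y"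
  using projective[OF assms(3)] assms(1,4) HomD(2,3)[OF assms(2)] unfolding projective_object_def
  by blast

lemma epi_if_elements:
  assumes e: "e \<in> Hom X a b"
    and s: "\<And>\<alpha> y. \<lbrakk>\<alpha> \<in> A; y \<in> Hom X (G \<alpha>) b\<rbrakk> \<Longrightarrow> \<exists>x \<in> Hom X (G \<alpha>) a. e \<cdot> x = y"
  shows "epi_arr X e"
proof (rule epi_arrI[OF e])
  fix t u v assume u: "u \<in> Hom X b t" and v: "v \<in> Hom X b t" and eq: "u \<cdot> e = v \<cdot> e"
  show "u = v"
  proof (rule generators_separate[OF u v])
    fix \<alpha> y assume \<alpha>: "\<alpha> \<in> A" and y: "y \<in> Hom X (G \<alpha>) b"
    obtain x where x: "x \<in> Hom X (G \<alpha>) a" "e \<cdot> x = y" using s[OF \<alpha> y] by blast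
    show "u \<cdot> y = v \<cdot> y"
      using Comp_assoc[OF x(1) e u] Comp_assoc[OF x(1) e v] eq x(2) by simp
  qed
qed

text \<open>By compactness \<open>y\<close> is the image of a family \<open>x\<close> of finite
  support, hence a finite sum of the \<iota> i \<cdot> x i. Of this only the consequence for kernels
  is recorded: what annihilates the finitely many \<open>x i\<close> on the right annihilates
  \<open>y\<close> too.\<close>

lemma compact_support:
  fixes I :: "'u set"
  assumes \<alpha>: "\<alpha> \<in> A" and I: "|I| <o \<kappa>" "\<And>i. i \<in> I \<Longrightarrow> N i \<in> Obj X" and P: "is_coproduct X I N P \<iota>"
    and y: "y \<in> Hom X (G \<alpha>) P"
  obtains J x where "finite J" "J \<subseteq> I" "\<forall>i\<in>J. x i \<in> Hom X (G \<alpha>) (N i)"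
    "\<forall>t. \<forall>u \<in> Hom X t (G \<alpha>). (\<forall>i\<in>J. x i \<cdot> u = Zero X t (N i)) \<longrightarrow> y \<cdot> u = Zero X t P"
proof -
  let ?S = "sum_group I (\<lambda>i. Hom_group X (G \<alpha>) (N i))" and ?H = "Hom_group X (G \<alpha>) P"
  let ?\<phi> = "\<lambda>x. gfinprod ?H (\<lambda>i. \<iota> i \<cdot> x i) I"
  have PO: "P \<in> Obj X" using P by (simp add: is_coproduct_def)
  have "?\<phi> \<in> iso ?S ?H"
    using compact[OF \<alpha>] I P unfolding compact_object_def by blast
  then have "?\<phi> ` carrier ?S = carrier ?H" unfolding iso_def bij_betw_def by blast
  moreover have "y \<in> carrier ?H" using y by (simp add: Hom_group_def)
  ultimately obtain x where x: "x \<in> carrier ?S" "y = ?\<phi> x" by blast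
  have grp: "\<And>i. i \<in> I \<Longrightarrow> group (Hom_group X (G \<alpha>) (N i))"
    using Hom_comm_group[OF G_Obj[OF \<alpha>] I(2)] by (simp add: comm_group_def)
  have carrier: "carrier ?S = {x \<in> \<Pi>\<^sub>E i\<in>I. carrier (Hom_group X (G \<alpha>) (N i)).
      finite {i \<in> I. x i \<noteq> \<one>\<^bsub>Hom_group X (G \<alpha>) (N i)\<^esub>}}"
    by (rule carrier_sum_group) (rule grp)
  have xc: "x \<in> (\<Pi>\<^sub>E i\<in>I. carrier (Hom_group X (G \<alpha>) (N i)))"
    "finite {i \<in> I. x i \<noteq> \<one>\<^bsub>Hom_group X (G \<alpha>) (N i)\<^esub>}"
    using x(1) unfolding carrier by auto
  have xi: "x i \<in> Hom X (G \<alpha>) (N i)" if "i \<in> I" for i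
    using xc(1) that by (auto simp: Hom_group_def)
  \<comment> \<open>This is the support over which \<open>gfinprod\<close> actually sums. It may be
    smaller than the support of \<open>x\<close>, which makes it finite.\<close>
  define J where "J = {i \<in> I. \<iota> i \<cdot> x i \<noteq> Zero X (G \<alpha>) P}"
  have "J \<subseteq> {i \<in> I. x i \<noteq> \<one>\<^bsub>Hom_group X (G \<alpha>) (N i)\<^esub>}"
    using Comp_Zero[OF coproduct_inj[OF P] G_Obj[OF \<alpha>]] by (auto simp: J_def Hom_group_def)
  then have fin: "finite J" using xc(2) by (rule finite_subset)
  have y_eq: "y = finprod ?H (\<lambda>i. \<iota> i \<cdot> x i) J"
    using x(2) fin unfolding gfinprod_def J_def by (simp add: Hom_group_def)
  show thesis
  proof (rule that[OF fin]; (intro allI ballI impI)?)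
    show "J \<subseteq> I" by (auto simp: J_def)
    show "x i \<in> Hom X (G \<alpha>) (N i)" if "i \<in> J" for i using xi that by (simp add: J_def)
    fix t u assume u: "u \<in> Hom X t (G \<alpha>)" and z: "\<forall>i\<in>J. x i \<cdot> u = Zero X t (N i)"
    show "y \<cdot> u = Zero X t P"
      unfolding y_eq
    proof (rule finprod_Comp_Zero[OF fin G_Obj[OF \<alpha>] PO u])
      fix i assume i: "i \<in> J"
      then have iI: "i \<in> I" by (simp add: J_def)
      show "\<iota> i \<cdot> x i \<in> Hom X (G \<alpha>) P" by (rule Comp_Hom[OF xi[OF iI] coproduct_inj[OF P iI]])
      show "\<iota> i \<cdot> x i \<cdot> u = Zero X t P"
        unfolding Comp_assoc[OF u xi[OF iI] coproduct_inj[OF P iI]] bspec[OF z i]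
        by (rule Comp_Zero[OF coproduct_inj[OF P iI] Hom_Obj(1)[OF u]])
    qed
  qed
qed

text \<open>The image is the cokernel of the kernel of \<open>x\<close>. An element of it
  annihilated by \<open>m\<close> lifts along \<open>q\<close> by projectivity; the lift is
  annihilated by \<open>x\<close>, so it factors through \<open>k\<close> and \<open>q\<close> sends
  it to zero.\<close>

lemma image_factorization:
  assumes x: "x \<in> Hom X a M"
  obtains Q q m where "q \<in> Hom X a Q" "epi_arr X q" "m \<in> Hom X Q M" "mono_arr X m" "m \<cdot> q = x"
    "kernel_class X q = kernel_class X x"
proof -
  obtain k where k: "is_kernel X x k" using kernel_exists[OF x] .
  note k' = kernel_Hom[OF k x]
  obtain q where q: "is_cokernel X k q" using cokernel_exists[OF k'(1)] .
  note q' = cokernel_Hom[OF q k'(1)]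
  obtain m where m: "m \<in> Hom X (Cod X q) M" "m \<cdot> q = x" using cokernel_desc[OF q k'(1) x k'(2)] .
  have e: "epi_arr X q" using cokernel_epi[OF q] .
  have "mono_arr X m"
  proof (rule mono_if_elements[OF m(1)])
    fix \<alpha> y assume \<alpha>: "\<alpha> \<in> A" and y: "y \<in> Hom X (G \<alpha>) (Cod X q)" "m \<cdot> y = Zero X (G \<alpha>) M"
    obtain z where z: "z \<in> Hom X (G \<alpha>) a" "q \<cdot> z = y" using epi_lift[OF e q'(1) \<alpha> y(1)] .
    have "x \<cdot> z = Zero X (G \<alpha>) M" using Comp_assoc[OF z(1) q'(1) m(1)] m(2) z(2) y(2) by simp
    then obtain w where w: "w \<in> Hom X (G \<alpha>) (Dom X k)" "k \<cdot> w = z" using kernel_lift[OF k x z(1)] by blast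
    show "y = Zero X (G \<alpha>) (Cod X q)"
      using Comp_assoc[OF w(1) k'(1) q'(1)] q'(2) w(2) z(2) Zero_Comp[OF w(1) Hom_Obj(2)[OF q'(1)]] by simp
  qed
  moreover have "kernel_class X q = kernel_class X x"
  proof -
    have "kernel_le X q x"
    proof (rule kernel_leI[OF q'(1) x])
      fix t u assume u: "u \<in> Hom X t a" "q \<cdot> u = Zero X t (Cod X q)"
      then show "x \<cdot> u = Zero X t M"
        using Comp_assoc[OF u(1) q'(1) m(1)] m(2) Comp_Zero[OF m(1) Hom_Obj(1)[OF u(1)]] by simp
    qed
    moreover have "kernel_le X x q" using kernel_le_iff[OF k x q'(1)] q'(2) by simp
    ultimately show ?thesis using kernel_class_eq_iff[OF q'(1) x] by simp
  qed
  ultimately show thesis using that[OF q'(1) e m(1) _ m(2)] by blast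
qed

text \<open>The index \<alpha> is not stored, so that this is a plain set of arrows to be
  enumerated; \<open>Dom X\<close> recovers the generator.\<close>

definition elements :: "'o \<Rightarrow> 'm set" where
  "elements M = (\<Union>\<alpha>\<in>A. Hom X (G \<alpha>) M)"

lemma small_elements: "M \<in> Obj X \<Longrightarrow> |elements M| <o \<kappa>"
  unfolding elements_def by (rule small_UN[OF small_A], rule small_Hom[OF G_Obj])

text \<open>Every element of \<open>T\<close> is the restriction of \<open>v\<close> to one of the
  summands, so it lifts tautologically. Morphisms out of \<open>T\<close> can thus be built from
  prescribed values on elements.\<close>

lemma cover:
  assumes T: "T \<in> Obj X"
  obtains J :: "'u set" and x R \<rho> v where "|J| <o \<kappa>" "x ` J = elements T"
    "is_coproduct X J (\<lambda>j. Dom X (x j)) R \<rho>"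
    "v \<in> Hom X R T" "\<forall>j\<in>J. v \<cdot> \<rho> j = x j" "epi_arr X v"
proof -
  obtain J :: "'u set" and x where J: "|J| <o \<kappa>" "x ` J = elements T"
    using small_reindex[OF small_elements[OF T]] .
  have x: "x j \<in> Hom X (Dom X (x j)) T" if "j \<in> J" for j
    using that J(2) by (auto simp: elements_def Hom_iff)
  then have "\<forall>j\<in>J. Dom X (x j) \<in> Obj X" using Hom_Obj(1) by blast
  then obtain R \<rho> where R: "is_coproduct X J (\<lambda>j. Dom X (x j)) R \<rho>"
    using coproducts[OF J(1), of "\<lambda>j. Dom X (x j)"] by blast
  obtain v where v: "v \<in> Hom X R T" "\<forall>j\<in>J. v \<cdot> \<rho> j = x j"
    using ex1_implies_ex[OF coproduct_ex1[of J _ R \<rho> T x, OF R T x]] by blast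
  have "epi_arr X v"
  proof (rule epi_if_elements[OF v(1)])
    fix \<alpha> y assume "\<alpha> \<in> A" and y: "y \<in> Hom X (G \<alpha>) T"
    then have "y \<in> elements T" by (auto simp: elements_def)
    then obtain j where j: "j \<in> J" "y = x j" using J(2) by blast
    then show "\<exists>z \<in> Hom X (G \<alpha>) R. v \<cdot> z = y"
      using coproduct_inj[OF R j(1)] bspec[OF v(2) j(1)] HomD(2)[OF y] by auto
  qed
  then show thesis using that[OF J R v] by blast
qed

text \<open>A product of the \<open>N i\<close> is the quotient of a coproduct \<open>W\<close> of generators, one for each
  family of elements of the \<open>N i\<close>, by the common kernel of the projections \<open>W \<rightarrow> N i\<close>.\<close>

lemma products_exist:
  fixes I :: "'u set"
  assumes I: "|I| <o \<kappa>" and N: "\<And>i. i \<in> I \<Longrightarrow> N i \<in> Obj X"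
  shows "\<exists>P \<pi>. is_product X I N P \<pi>"
proof -
  \<comment> \<open>A member of \<open>F\<close> is what an element of the product should be: a
    generator together with one element of each \<open>N i\<close>. The summands of \<open>W\<close>
    are indexed by these.\<close>
  define F where "F = (\<Union>\<alpha>\<in>A. Pair \<alpha> ` (\<Pi>\<^sub>E i\<in>I. Hom X (G \<alpha>) (N i)))"
  have "|F| <o \<kappa>"
    unfolding F_def
    by (rule small_UN[OF small_A], rule small_image, rule small_PiE[OF I], rule small_Hom[OF G_Obj N])
  then obtain L :: "'u set" and \<phi> where L: "|L| <o \<kappa>" "\<phi> ` L = F" by (rule small_reindex)
  have \<phi>A: "fst (\<phi> l) \<in> A" and \<phi>H: "\<And>i. i \<in> I \<Longrightarrow> snd (\<phi> l) i \<in> Hom X (G (fst (\<phi> l))) (N i)"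
    if "l \<in> L" for l
  proof -
    have "\<phi> l \<in> F" using that L(2) by blast
    then show "fst (\<phi> l) \<in> A" "\<And>i. i \<in> I \<Longrightarrow> snd (\<phi> l) i \<in> Hom X (G (fst (\<phi> l))) (N i)"
      by (auto simp: F_def)
  qed
  have "\<forall>l\<in>L. G (fst (\<phi> l)) \<in> Obj X" using \<phi>A G_Obj by blast
  then obtain W \<iota> where W: "is_coproduct X L (\<lambda>l. G (fst (\<phi> l))) W \<iota>"
    using coproducts[OF L(1), of "\<lambda>l. G (fst (\<phi> l))"] by blast
  have "\<exists>p. p \<in> Hom X W (N i) \<and> (\<forall>l\<in>L. p \<cdot> \<iota> l = snd (\<phi> l) i)" if "i \<in> I" for i
    by (rule ex1_implies_ex[OF coproduct_ex1[OF W N[OF that] \<phi>H[OF _ that]]])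
  then obtain p where p: "\<And>i. i \<in> I \<Longrightarrow> p i \<in> Hom X W (N i)"
    "\<And>i l. \<lbrakk>i \<in> I; l \<in> L\<rbrakk> \<Longrightarrow> p i \<cdot> \<iota> l = snd (\<phi> l) i"
    by metis
  have WO: "W \<in> Obj X" using W by (simp add: is_coproduct_def)
  \<comment> \<open>All elements of the common kernel of the \<open>p i\<close>. The coproduct
    \<open>V\<close> of their domains maps to \<open>W\<close> by \<open>s\<close>, whose cokernel
    therefore divides out that kernel although the kernel itself is never formed.\<close>
  define S where "S = (\<Union>\<alpha>\<in>A. {u \<in> Hom X (G \<alpha>) W. \<forall>i\<in>I. p i \<cdot> u = Zero X (G \<alpha>) (N i)})"
  have "S \<subseteq> elements W" by (auto simp: S_def elements_def)
  then have "|S| <o \<kappa>" by (rule small_subset[OF small_elements[OF WO]])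
  then obtain K :: "'u set" and \<psi> where K: "|K| <o \<kappa>" "\<psi> ` K = S" by (rule small_reindex)
  have \<psi>: "\<psi> k \<in> Hom X (Dom X (\<psi> k)) W" "\<And>i. i \<in> I \<Longrightarrow> p i \<cdot> \<psi> k = Zero X (Dom X (\<psi> k)) (N i)"
    if "k \<in> K" for k
  proof -
    have "\<psi> k \<in> S" using K(2) that by blast
    then show "\<psi> k \<in> Hom X (Dom X (\<psi> k)) W" "\<And>i. i \<in> I \<Longrightarrow> p i \<cdot> \<psi> k = Zero X (Dom X (\<psi> k)) (N i)"
      by (auto simp: S_def Hom_iff)
  qed
  have "\<forall>k\<in>K. Dom X (\<psi> k) \<in> Obj X" using Hom_Obj(1)[OF \<psi>(1)] by blast
  then obtain V \<nu> where V: "is_coproduct X K (\<lambda>k. Dom X (\<psi> k)) V \<nu>"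
    using coproducts[OF K(1), of "\<lambda>k. Dom X (\<psi> k)"] by blast
  obtain s where s: "s \<in> Hom X V W" "\<And>k. k \<in> K \<Longrightarrow> s \<cdot> \<nu> k = \<psi> k"
    using coproduct_induced[OF V WO \<psi>(1)] by blast
  obtain c where c: "is_cokernel X s c" using cokernel_exists[OF s(1)] .
  note c' = cokernel_Hom[OF c s(1)] and ce = cokernel_epi[OF c]
  let ?Q = "Cod X c"
  have VO: "V \<in> Obj X" using Hom_Obj(1)[OF s(1)] .
  have "\<exists>q \<in> Hom X ?Q (N i). q \<cdot> c = p i" if i: "i \<in> I" for i
  proof -
    have "p i \<cdot> s = Zero X V (N i)"
    proof (rule coproduct_eqI[OF V Comp_Hom[OF s(1) p(1)[OF i]] Zero_Hom[OF VO N[OF i]]])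
      fix k assume k: "k \<in> K"
      note \<nu> = coproduct_inj[OF V k]
      show "p i \<cdot> s \<cdot> \<nu> k = Zero X V (N i) \<cdot> \<nu> k"
        unfolding Comp_assoc[OF \<nu> s(1) p(1)[OF i]] s(2)[OF k] \<psi>(2)[OF k i] Zero_Comp[OF \<nu> N[OF i]] ..
    qed
    then show ?thesis using cokernel_desc[OF c s(1) p(1)[OF i]] by blast
  qed
  then obtain q where q: "\<And>i. i \<in> I \<Longrightarrow> q i \<in> Hom X ?Q (N i)" "\<And>i. i \<in> I \<Longrightarrow> q i \<cdot> c = p i" by metis
  have joint_zero: "y = Zero X t ?Q"
    if y: "y \<in> Hom X t ?Q" and z: "\<And>i. i \<in> I \<Longrightarrow> q i \<cdot> y = Zero X t (N i)" for t y
  proof (rule zero_if_elements[OF y])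
    fix \<alpha> x assume \<alpha>: "\<alpha> \<in> A" and x: "x \<in> Hom X (G \<alpha>) t"
    \<comment> \<open>The lift \<open>w\<close> is annihilated by every \<open>p i\<close>, so it is
      one of the summands from which \<open>s\<close> was built, and \<open>c\<close> annihilates
      it.\<close>
    obtain w where w: "w \<in> Hom X (G \<alpha>) W" "c \<cdot> w = y \<cdot> x"
      using epi_lift[OF ce c'(1) \<alpha> Comp_Hom[OF x y]] .
    have "p i \<cdot> w = Zero X (G \<alpha>) (N i)" if i: "i \<in> I" for i
    proof -
      have "p i \<cdot> w = q i \<cdot> y \<cdot> x"
        using Comp_assoc[OF w(1) c'(1) q(1)[OF i]] q(2)[OF i] w(2) Comp_assoc[OF x y q(1)[OF i]] by simp
      then show ?thesis using z[OF i] Zero_Comp[OF x N[OF i]] by simp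
    qed
    then have "w \<in> S" using w(1) \<alpha> by (auto simp: S_def)
    then obtain k where k: "k \<in> K" "w = \<psi> k" using K(2) by blast
    note \<nu> = coproduct_inj[OF V k(1)]
    have "y \<cdot> x = Zero X V ?Q \<cdot> \<nu> k"
      using w(2) k(2) s(2)[OF k(1)] Comp_assoc[OF \<nu> s(1) c'(1)] c'(2) by simp
    then show "y \<cdot> x = Zero X (G \<alpha>) ?Q"
      using Zero_Comp[OF \<nu> Hom_Obj(2)[OF c'(1)]] k(2) HomD(2)[OF w(1)] by simp
  qed
  have joint_mono: "y = y'"
    if y: "y \<in> Hom X t ?Q" "y' \<in> Hom X t ?Q" and eq: "\<And>i. i \<in> I \<Longrightarrow> q i \<cdot> y = q i \<cdot> y'" for t y y'
  proof -
    obtain d where d: "d \<in> Hom X t ?Q" "y = Plus X y' d" using difference[OF y] .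
    have "d = Zero X t ?Q"
    proof (rule joint_zero[OF d(1)])
      fix i assume i: "i \<in> I"
      have "Plus X (q i \<cdot> y') (q i \<cdot> d) = q i \<cdot> y'"
        using Comp_Plus_right[OF y(2) d(1) q(1)[OF i]] d(2) eq[OF i] by simp
      then show "q i \<cdot> d = Zero X t (N i)"
        by (rule Plus_left_cancel[OF Comp_Hom[OF y(2) q(1)[OF i]] Comp_Hom[OF d(1) q(1)[OF i]]])
    qed
    then show ?thesis using d(2) Plus_Zero(1)[OF y(2)] by simp
  qed
  have ex: "\<exists>h. h \<in> Hom X T ?Q \<and> (\<forall>i\<in>I. q i \<cdot> h = f i)"
    if T: "T \<in> Obj X" and f: "\<And>i. i \<in> I \<Longrightarrow> f i \<in> Hom X T (N i)" for T f
  proof -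
    obtain J :: "'u set" and x R \<rho> v where J: "|J| <o \<kappa>" "x ` J = elements T"
      and R: "is_coproduct X J (\<lambda>j. Dom X (x j)) R \<rho>"
      and v: "v \<in> Hom X R T" "\<forall>j\<in>J. v \<cdot> \<rho> j = x j" "epi_arr X v"
      using cover[OF T] .
    \<comment> \<open>Composing the given morphisms \<open>f i\<close> with an element of
      \<open>T\<close> yields a member of \<open>F\<close>, which names a summand of
      \<open>W\<close>. Sending the matching summand of \<open>R\<close> there defines
      \<open>w\<close>, a lift of the desired morphism to the covers.\<close>
    have "\<exists>l\<in>L. Dom X (x j) = G (fst (\<phi> l)) \<and> (\<forall>i\<in>I. snd (\<phi> l) i = f i \<cdot> x j)" if "j \<in> J" for j
    proof -
      have "x j \<in> elements T" using J(2) that by blast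
      then obtain \<alpha> where \<alpha>: "\<alpha> \<in> A" "x j \<in> Hom X (G \<alpha>) T" by (auto simp: elements_def)
      then have "(\<lambda>i\<in>I. f i \<cdot> x j) \<in> (\<Pi>\<^sub>E i\<in>I. Hom X (G \<alpha>) (N i))" using Comp_Hom[OF \<alpha>(2) f] by auto
      then have "(\<alpha>, \<lambda>i\<in>I. f i \<cdot> x j) \<in> F" using \<alpha>(1) unfolding F_def by blast
      then obtain l where "l \<in> L" "\<phi> l = (\<alpha>, \<lambda>i\<in>I. f i \<cdot> x j)" using L(2) by (metis imageE)
      then show ?thesis using HomD(2)[OF \<alpha>(2)] by (intro bexI[of _ l]) auto
    qed
    then obtain l where l: "\<And>j. j \<in> J \<Longrightarrow> l j \<in> L" "\<And>j. j \<in> J \<Longrightarrow> Dom X (x j) = G (fst (\<phi> (l j)))"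
      "\<And>j i. \<lbrakk>j \<in> J; i \<in> I\<rbrakk> \<Longrightarrow> snd (\<phi> (l j)) i = f i \<cdot> x j" by metis
    have \<iota>l: "\<iota> (l j) \<in> Hom X (Dom X (x j)) W" if "j \<in> J" for j
      using coproduct_inj[OF W l(1)[OF that]] l(2)[OF that] by simp
    obtain w where w: "w \<in> Hom X R W" "\<And>j. j \<in> J \<Longrightarrow> w \<cdot> \<rho> j = \<iota> (l j)"
      using coproduct_induced[OF R WO \<iota>l] by blast
    have pw: "p i \<cdot> w = f i \<cdot> v" if i: "i \<in> I" for i
    proof (rule coproduct_eqI[OF R Comp_Hom[OF w(1) p(1)[OF i]] Comp_Hom[OF v(1) f[OF i]]])
      fix j assume j: "j \<in> J"
      note \<rho> = coproduct_inj[OF R j]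
      show "p i \<cdot> w \<cdot> \<rho> j = f i \<cdot> v \<cdot> \<rho> j"
        unfolding Comp_assoc[OF \<rho> w(1) p(1)[OF i]] Comp_assoc[OF \<rho> v(1) f[OF i]] w(2)[OF j] bspec[OF v(2) j]
          p(2)[OF i l(1)[OF j]] l(3)[OF j i] ..
    qed
    note cw = Comp_Hom[OF w(1) c'(1)]
    have qcw: "q i \<cdot> (c \<cdot> w) = f i \<cdot> v" if i: "i \<in> I" for i
      using Comp_assoc[OF w(1) c'(1) q(1)[OF i]] q(2)[OF i] pw[OF i] by simp
    \<comment> \<open>Each \<open>q i\<close> turns c \<cdot> w into f i \<cdot> v, so by joint
      faithfulness of the \<open>q i\<close> it annihilates whatever \<open>v\<close> annihilates
      and descends to \<open>T\<close>.\<close>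
    have "kernel_le X v (c \<cdot> w)"
    proof (rule kernel_leI[OF v(1) cw])
      fix t u assume u: "u \<in> Hom X t R" "v \<cdot> u = Zero X t T"
      show "c \<cdot> w \<cdot> u = Zero X t ?Q"
      proof (rule joint_zero[OF Comp_Hom[OF u(1) cw]])
        fix i assume i: "i \<in> I"
        show "q i \<cdot> (c \<cdot> w \<cdot> u) = Zero X t (N i)"
          unfolding Comp_assoc[OF u(1) cw q(1)[OF i], symmetric] qcw[OF i] Comp_assoc[OF u(1) v(1) f[OF i]] u(2)
          by (rule Comp_Zero[OF f[OF i] Hom_Obj(1)[OF u(1)]])
      qed
    qed
    then obtain h where h: "h \<in> Hom X T ?Q" "h \<cdot> v = c \<cdot> w" using epi_factor[OF v(3,1) cw] by blast
    have "q i \<cdot> h = f i" if i: "i \<in> I" for i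
    proof (rule epi_cancel[OF v(3,1) Comp_Hom[OF h(1) q(1)[OF i]] f[OF i]])
      show "q i \<cdot> h \<cdot> v = f i \<cdot> v" unfolding Comp_assoc[OF v(1) h(1) q(1)[OF i]] h(2) by (rule qcw[OF i])
    qed
    then show ?thesis using h(1) by blast
  qed
  have "is_product X I N ?Q q"
    unfolding is_product_def
  proof (intro conjI ballI allI impI)
    show "?Q \<in> Obj X" using Hom_Obj(2)[OF c'(1)] .
    show "q i \<in> Hom X ?Q (N i)" if "i \<in> I" for i using q(1)[OF that] .
    fix T f assume T: "T \<in> Obj X" and f: "\<forall>i\<in>I. f i \<in> Hom X T (N i)"
    show "\<exists>!h. h \<in> Hom X T ?Q \<and> (\<forall>i\<in>I. q i \<cdot> h = f i)"
    proof (rule ex_ex1I)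
      show "\<exists>h. h \<in> Hom X T ?Q \<and> (\<forall>i\<in>I. q i \<cdot> h = f i)" using ex[OF T] f by blast
      fix h h' assume "h \<in> Hom X T ?Q \<and> (\<forall>i\<in>I. q i \<cdot> h = f i)" "h' \<in> Hom X T ?Q \<and> (\<forall>i\<in>I. q i \<cdot> h' = f i)"
      then show "h = h'" using joint_mono[of h T h'] by simp
    qed
  qed
  then show ?thesis by blast
qed

end

context abelian_category
begin

lemma is_quotientE:
  assumes "I \<in> subobjects X a" "is_quotient X I Q"
  obtains q where "q \<in> Hom X a Q" "epi_arr X q" "I = kernel_class X q"
proof -
  obtain M f where f: "f \<in> Hom X a M" "I = kernel_class X f"
    using subobject_kernel_class[OF assms(1)] by blast
  then show thesis using that assms(2) is_quotient_kernel_class[OF f(1)] by auto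
qed

lemma kernel_le_Comp:
  assumes "f \<in> Hom X a b" "g \<in> Hom X b c"
  shows "kernel_le X f (g \<cdot> f)"
proof (rule kernel_leI[OF assms(1) Comp_Hom[OF assms]])
  fix t u assume u: "u \<in> Hom X t a" "f \<cdot> u = Zero X t b"
  then show "g \<cdot> f \<cdot> u = Zero X t c"
    using Comp_assoc[OF u(1) assms] Comp_Zero[OF assms(2) Hom_Obj(1)[OF u(1)]] by simp
qed

lemma kernel_le_Comp_mono:
  assumes "f \<in> Hom X a b" "mono_arr X m" "m \<in> Hom X b c"
  shows "kernel_le X (m \<cdot> f) f"
proof (rule kernel_leI[OF Comp_Hom[OF assms(1,3)] assms(1)])
  fix t u assume u: "u \<in> Hom X t a" "m \<cdot> f \<cdot> u = Zero X t c"
  then show "f \<cdot> u = Zero X t b"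
    using Comp_assoc[OF u(1) assms(1,3)] mono_Comp_Zero_iff[OF assms(2,3) Comp_Hom[OF u(1) assms(1)]] by simp
qed

lemma epi_if_Comp_epi:
  assumes f: "f \<in> Hom X a b" and g: "g \<in> Hom X b c" and gf: "epi_arr X (g \<cdot> f)"
  shows "epi_arr X g"
proof (rule epi_arrI[OF g])
  fix t u v assume u: "u \<in> Hom X c t" and v: "v \<in> Hom X c t" and eq: "u \<cdot> g = v \<cdot> g"
  show "u = v"
    using epi_cancel[OF gf Comp_Hom[OF f g] u v] Comp_assoc[OF f g u] Comp_assoc[OF f g v] eq by simp
qed

end

section \<open>The correspondence\<close>

lemma weakly_closed_mono: "\<lbrakk>weakly_closed \<kappa> X Z; mono_arr X m; m \<in> Hom X a b; b \<in> Z\<rbrakk> \<Longrightarrow> a \<in> Z"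
  unfolding weakly_closed_def by (metis HomD(2,3))

lemma weakly_closed_epi: "\<lbrakk>weakly_closed \<kappa> X Z; epi_arr X e; e \<in> Hom X a b; a \<in> Z\<rbrakk> \<Longrightarrow> b \<in> Z"
  unfolding weakly_closed_def by (metis HomD(2,3))

lemma weakly_closed_coproduct:
  fixes \<kappa> :: "'u rel" and I :: "'u set"
  shows "\<lbrakk>weakly_closed \<kappa> X Z; |I| <o \<kappa>; \<forall>i\<in>I. N i \<in> Z; is_coproduct X I N P \<iota>\<rbrakk> \<Longrightarrow> P \<in> Z"
  unfolding weakly_closed_def by blast

lemma closed_product:
  fixes \<kappa> :: "'u rel" and I :: "'u set"
  shows "\<lbrakk>closed_subcategory \<kappa> X Z; |I| <o \<kappa>; \<forall>i\<in>I. N i \<in> Z; is_product X I N P \<pi>\<rbrakk> \<Longrightarrow> P \<in> Z"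
  unfolding closed_subcategory_def by blast

lemma generated_subcategoryI:
  fixes \<kappa> :: "'u rel" and I :: "'u set"
  assumes "|I| <o \<kappa>" "\<forall>i\<in>I. N i \<in> C" "is_coproduct X I N P \<iota>" "epi_arr X e" "e \<in> Hom X P M"
  shows "M \<in> generated_subcategory \<kappa> X C"
  unfolding generated_subcategory_def
  by (rule CollectI, rule exI[of _ I], rule exI[of _ N], rule exI[of _ P], rule exI[of _ \<iota>], rule exI[of _ e])
    (simp add: assms(1-4) HomD(2,3)[OF assms(5)])

lemma generated_subset_weakly_closed:
  fixes \<kappa> :: "'u rel"
  assumes "weakly_closed \<kappa> X Z" "C \<subseteq> Z"
  shows "generated_subcategory \<kappa> X C \<subseteq> Z"
proof
  fix M assume "M \<in> generated_subcategory \<kappa> X C"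
  then obtain I :: "'u set" and N P \<iota> e where *: "|I| <o \<kappa>" "\<forall>i\<in>I. N i \<in> C" "is_coproduct X I N P \<iota>"
    "epi_arr X e" "Dom X e = P" "Cod X e = M"
    unfolding generated_subcategory_def by blast
  have "P \<in> Z" using weakly_closed_coproduct[OF assms(1) *(1) _ *(3)] *(2) assms(2) by blast
  moreover have "e \<in> Hom X P M" using *(4-6) by (simp add: epi_arr_def Hom_iff)
  ultimately show "M \<in> Z" using weakly_closed_epi[OF assms(1) *(4)] by blast
qed

context compact_projective_generators
begin

lemma kernel_le_if_elements:
  assumes f: "f \<in> Hom X a b" and g: "g \<in> Hom X a c"
    and le: "\<And>\<alpha> x. \<lbrakk>\<alpha> \<in> A; x \<in> Hom X (G \<alpha>) a; f \<cdot> x = Zero X (G \<alpha>) b\<rbrakk> \<Longrightarrow> g \<cdot> x = Zero X (G \<alpha>) c"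
  shows "kernel_le X f g"
proof (rule kernel_leI[OF f g])
  fix t u assume u: "u \<in> Hom X t a" "f \<cdot> u = Zero X t b"
  show "g \<cdot> u = Zero X t c"
  proof (rule zero_if_elements[OF Comp_Hom[OF u(1) g]])
    fix \<alpha> x assume \<alpha>: "\<alpha> \<in> A" and x: "x \<in> Hom X (G \<alpha>) t"
    have "f \<cdot> (u \<cdot> x) = Zero X (G \<alpha>) b"
      using Comp_assoc[OF x u(1) f] u(2) Zero_Comp[OF x Hom_Obj(2)[OF f]] by simp
    then have "g \<cdot> (u \<cdot> x) = Zero X (G \<alpha>) c" by (rule le[OF \<alpha> Comp_Hom[OF x u(1)]])
    then show "g \<cdot> u \<cdot> x = Zero X (G \<alpha>) c" using Comp_assoc[OF x u(1) g] by simp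
  qed
qed

text \<open>The monomorphism \<open>u\<close> is the kernel of its cokernel \<open>p\<close>. The
  morphisms \<open>p\<close> and \<open>v\<close> have the same kernel, by v \<cdot> u = 0 in one
  direction and by exactness on elements in the other.\<close>

lemma short_exact_if_elements:
  assumes u: "u \<in> Hom X a b" "mono_arr X u" and v: "v \<in> Hom X b c" "epi_arr X v"
    and vu: "v \<cdot> u = Zero X a c"
    and ex: "\<And>\<alpha> y. \<lbrakk>\<alpha> \<in> A; y \<in> Hom X (G \<alpha>) b; v \<cdot> y = Zero X (G \<alpha>) c\<rbrakk> \<Longrightarrow> \<exists>x \<in> Hom X (G \<alpha>) a. u \<cdot> x = y"
  shows "short_exact X u v"
proof -
  obtain p where p: "is_cokernel X u p" using cokernel_exists[OF u(1)] .
  note p' = cokernel_Hom[OF p u(1)]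
  have k: "is_kernel X p u" using mono_kernel_of_cokernel[OF u(2,1) p] .
  have "kernel_le X p v" using kernel_le_iff[OF k p'(1) v(1)] vu HomD(2)[OF u(1)] by simp
  moreover have "kernel_le X v p"
  proof (rule kernel_le_if_elements[OF v(1) p'(1)])
    fix \<alpha> y assume \<alpha>: "\<alpha> \<in> A" and y: "y \<in> Hom X (G \<alpha>) b" "v \<cdot> y = Zero X (G \<alpha>) c"
    obtain x where x: "x \<in> Hom X (G \<alpha>) a" "u \<cdot> x = y" using ex[OF \<alpha> y] by blast
    then show "p \<cdot> y = Zero X (G \<alpha>) (Cod X p)"
      using Comp_assoc[OF x(1) u(1) p'(1)] p'(2) Zero_Comp[OF x(1) Hom_Obj(2)[OF p'(1)]] by simp
  qed
  ultimately have "kernel_class X v = kernel_class X p" using kernel_class_eq_iff[OF v(1) p'(1)] by simp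
  then have "is_kernel X v u" using k by (auto simp: kernel_class_def)
  then show ?thesis
    using epi_cokernel_of_kernel[OF v(2,1)] by (simp add: short_exact_def)
qed

text \<open>The analogue of the discrete modules over a linearly topologized ring: the annihilator
  of every element is open.\<close>

definition discrete_objects :: "('a \<Rightarrow> 'm set set) \<Rightarrow> 'o set" where
  "discrete_objects \<F> = {M \<in> Obj X. \<forall>\<alpha>\<in>A. \<forall>x \<in> Hom X (G \<alpha>) M. kernel_class X x \<in> \<F> \<alpha>}"

lemma discreteI:
  "\<lbrakk>M \<in> Obj X; \<And>\<alpha> x. \<lbrakk>\<alpha> \<in> A; x \<in> Hom X (G \<alpha>) M\<rbrakk> \<Longrightarrow> kernel_class X x \<in> \<F> \<alpha>\<rbrakk> \<Longrightarrow> M \<in> discrete_objects \<F>"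
  by (simp add: discrete_objects_def)

lemma discreteD: "\<lbrakk>M \<in> discrete_objects \<F>; \<alpha> \<in> A; x \<in> Hom X (G \<alpha>) M\<rbrakk> \<Longrightarrow> kernel_class X x \<in> \<F> \<alpha>"
  by (simp add: discrete_objects_def)

lemma filter_system_filter: "\<lbrakk>filter_system X A G \<F>; \<alpha> \<in> A\<rbrakk> \<Longrightarrow> sub_filter X (G \<alpha>) (\<F> \<alpha>)"
  by (simp add: filter_system_def)

lemma filter_system_subobject: "\<lbrakk>filter_system X A G \<F>; \<alpha> \<in> A; I \<in> \<F> \<alpha>\<rbrakk> \<Longrightarrow> I \<in> subobjects X (G \<alpha>)"
  using filter_system_filter unfolding sub_filter_def by blast

lemma filter_system_preimage:
  assumes "filter_system X A G \<F>" "\<alpha> \<in> A" "\<beta> \<in> A" "f \<in> Hom X (G \<alpha>) (G \<beta>)" "g \<in> Hom X (G \<beta>) c"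
    "kernel_class X g \<in> \<F> \<beta>"
  shows "kernel_class X (g \<cdot> f) \<in> \<F> \<alpha>"
proof -
  have "sub_preimage X f (kernel_class X g) \<in> \<F> \<alpha>"
    using assms(1-4,6) unfolding filter_system_def by blast
  then show ?thesis using sub_preimage_kernel_class[OF assms(4,5)] by simp
qed

text \<open>An element of \<open>Q\<close> lifts along \<open>q\<close> to a morphism between
  generators, so its kernel is the preimage of a member of the filter. Here the compatibility of the
  filters with morphisms enters.\<close>

lemma discrete_quotient_of_generator:
  assumes F: "filter_system X A G \<F>" and \<beta>: "\<beta> \<in> A"
    and q: "q \<in> Hom X (G \<beta>) Q" "epi_arr X q" "kernel_class X q \<in> \<F> \<beta>"
  shows "Q \<in> discrete_objects \<F>"
proof (rule discreteI[OF Hom_Obj(2)[OF q(1)]])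
  fix \<alpha> x assume \<alpha>: "\<alpha> \<in> A" and x: "x \<in> Hom X (G \<alpha>) Q"
  obtain z where z: "z \<in> Hom X (G \<alpha>) (G \<beta>)" "q \<cdot> z = x" using epi_lift[OF q(2,1) \<alpha> x] .
  show "kernel_class X x \<in> \<F> \<alpha>" using filter_system_preimage[OF F \<alpha> \<beta> z(1) q(1,3)] z(2) by simp
qed

lemma discrete_is_quotient:
  assumes F: "filter_system X A G \<F>" and \<beta>: "\<beta> \<in> A" and I: "I \<in> \<F> \<beta>" "is_quotient X I Q"
  shows "Q \<in> discrete_objects \<F>"
proof -
  obtain q where "q \<in> Hom X (G \<beta>) Q" "epi_arr X q" "I = kernel_class X q"
    using is_quotientE[OF filter_system_subobject[OF F \<beta> I(1)] I(2)] .
  then show ?thesis using discrete_quotient_of_generator[OF F \<beta>] I(1) by blast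
qed

text \<open>Composing with a monomorphism does not change the kernel of an element; an element of a
  quotient has a lift, whose kernel is at most smaller; an element of a coproduct is handled by
  \<open>compact_support\<close> and finite intersections.\<close>

lemma discrete_weakly_closed:
  assumes F: "filter_system X A G \<F>"
  shows "weakly_closed \<kappa> X (discrete_objects \<F>)"
  unfolding weakly_closed_def
proof (intro conjI allI impI)
  show "discrete_objects \<F> \<subseteq> Obj X" by (auto simp: discrete_objects_def)
next
  fix m assume *: "mono_arr X m \<and> Cod X m \<in> discrete_objects \<F>"
  then have m: "m \<in> Hom X (Dom X m) (Cod X m)" by (simp add: mono_arr_def Hom_iff)
  show "Dom X m \<in> discrete_objects \<F>"
  proof (rule discreteI[OF Hom_Obj(1)[OF m]])
    fix \<alpha> x assume \<alpha>: "\<alpha> \<in> A" and x: "x \<in> Hom X (G \<alpha>) (Dom X m)"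
    note mx = Comp_Hom[OF x m]
    have "kernel_class X (m \<cdot> x) \<in> \<F> \<alpha>" using discreteD[OF conjunct2[OF *] \<alpha> mx] .
    then show "kernel_class X x \<in> \<F> \<alpha>"
      by (rule sub_filter_up[OF filter_system_filter[OF F \<alpha>] mx _ x kernel_le_Comp_mono[OF x conjunct1[OF *] m]])
  qed
next
  fix e assume *: "epi_arr X e \<and> Dom X e \<in> discrete_objects \<F>"
  then have e: "e \<in> Hom X (Dom X e) (Cod X e)" by (simp add: epi_arr_def Hom_iff)
  show "Cod X e \<in> discrete_objects \<F>"
  proof (rule discreteI[OF Hom_Obj(2)[OF e]])
    fix \<alpha> x assume \<alpha>: "\<alpha> \<in> A" and x: "x \<in> Hom X (G \<alpha>) (Cod X e)"
    obtain y where y: "y \<in> Hom X (G \<alpha>) (Dom X e)" "e \<cdot> y = x"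
      using epi_lift[OF conjunct1[OF *] e \<alpha> x] .
    have "kernel_le X y x" using kernel_le_Comp[OF y(1) e] y(2) by simp
    then show "kernel_class X x \<in> \<F> \<alpha>"
      by (rule sub_filter_up[OF filter_system_filter[OF F \<alpha>] y(1) discreteD[OF conjunct2[OF *] \<alpha> y(1)] x])
  qed
next
  fix I :: "'u set" and N P \<iota>
  assume *: "|I| <o \<kappa> \<and> (\<forall>i\<in>I. N i \<in> discrete_objects \<F>) \<and> is_coproduct X I N P \<iota>"
  then have I: "|I| <o \<kappa>" and N: "\<And>i. i \<in> I \<Longrightarrow> N i \<in> discrete_objects \<F>" and P: "is_coproduct X I N P \<iota>"
    by auto
  have NO: "N i \<in> Obj X" if "i \<in> I" for i using N[OF that] by (simp add: discrete_objects_def)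
  show "P \<in> discrete_objects \<F>"
  proof (rule discreteI)
    show "P \<in> Obj X" using P by (simp add: is_coproduct_def)
    fix \<alpha> y assume \<alpha>: "\<alpha> \<in> A" and y: "y \<in> Hom X (G \<alpha>) P"
    obtain J x where J: "finite J" "J \<subseteq> I" "\<forall>i\<in>J. x i \<in> Hom X (G \<alpha>) (N i)"
      "\<forall>t. \<forall>u \<in> Hom X t (G \<alpha>). (\<forall>i\<in>J. x i \<cdot> u = Zero X t (N i)) \<longrightarrow> y \<cdot> u = Zero X t P"
      using compact_support[OF \<alpha> I NO P y] .
    show "kernel_class X y \<in> \<F> \<alpha>"
    proof (rule sub_filter_finite[OF filter_system_filter[OF F \<alpha>] G_Obj[OF \<alpha>] J(1) _ _ y])
      show x: "x i \<in> Hom X (G \<alpha>) (N i)" if "i \<in> J" for i using J(3) that by blast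
      show "kernel_class X (x i) \<in> \<F> \<alpha>" if "i \<in> J" for i
        using discreteD[OF N \<alpha> x[OF that]] that J(2) by blast
      show "y \<cdot> u = Zero X t P"
        if "u \<in> Hom X t (G \<alpha>)" "\<And>i. i \<in> J \<Longrightarrow> x i \<cdot> u = Zero X t (N i)" for t u
        using J(4) that by blast
    qed
  qed
qed

text \<open>One inclusion holds because the discrete objects are weakly closed and contain the
  generating quotients. Conversely, an object is covered by the coproduct of the images of all its
  elements, and the image of an element is the quotient of a generator by its kernel.\<close>

lemma subcategory_of_system_eq:
  assumes F: "filter_system X A G \<F>"
  shows "subcategory_of_system \<kappa> X A \<F> = discrete_objects \<F>"
proof (intro equalityI subsetI)
  fix M assume "M \<in> subcategory_of_system \<kappa> X A \<F>"
  moreover have "{Q. \<exists>\<alpha>\<in>A. \<exists>I \<in> \<F> \<alpha>. is_quotient X I Q} \<subseteq> discrete_objects \<F>"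
    using discrete_is_quotient[OF F] by blast
  ultimately show "M \<in> discrete_objects \<F>"
    using generated_subset_weakly_closed[OF discrete_weakly_closed[OF F]]
    unfolding subcategory_of_system_def by blast
next
  fix M assume M: "M \<in> discrete_objects \<F>"
  then have MO: "M \<in> Obj X" by (simp add: discrete_objects_def)
  obtain I :: "'u set" and x where I: "|I| <o \<kappa>" "x ` I = elements M"
    using small_reindex[OF small_elements[OF MO]] .
  let ?C = "{Q. \<exists>\<alpha>\<in>A. \<exists>I \<in> \<F> \<alpha>. is_quotient X I Q}"
  \<comment> \<open>Image factorization of the element \<open>x i\<close>; the image is named
    \<open>Cod X q\<close>, so that only \<open>q\<close> and \<open>m\<close> have to be chosen for
    each index.\<close>
  have "\<exists>q m. q \<in> Hom X (Dom X (x i)) (Cod X q) \<and> Cod X q \<in> ?C \<and> m \<in> Hom X (Cod X q) M \<and> m \<cdot> q = x i"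
    if "i \<in> I" for i
  proof -
    have "x i \<in> elements M" using I(2) that by blast
    then obtain \<alpha> where \<alpha>: "\<alpha> \<in> A" "x i \<in> Hom X (G \<alpha>) M" by (auto simp: elements_def)
    obtain Q q m where *: "q \<in> Hom X (G \<alpha>) Q" "epi_arr X q" "m \<in> Hom X Q M" "mono_arr X m" "m \<cdot> q = x i"
      "kernel_class X q = kernel_class X (x i)" using image_factorization[OF \<alpha>(2)] .
    have "kernel_class X (x i) \<in> \<F> \<alpha>" using discreteD[OF M \<alpha>] .
    moreover have "is_quotient X (kernel_class X (x i)) Q"
      using is_quotient_kernel_class[OF \<alpha>(2)] *(1,2,6) by blast
    ultimately have "Q \<in> ?C" using \<alpha>(1) by blast
    moreover have "Cod X q = Q" "Dom X (x i) = G \<alpha>" using HomD(3)[OF *(1)] HomD(2)[OF \<alpha>(2)] .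
    ultimately show ?thesis using *(1,3,5) by (intro exI[of _ q] exI[of _ m]) simp
  qed
  then have "\<forall>i\<in>I. \<exists>q m. q \<in> Hom X (Dom X (x i)) (Cod X q) \<and> Cod X q \<in> ?C \<and> m \<in> Hom X (Cod X q) M \<and> m \<cdot> q = x i"
    by (rule ballI)
  from bchoice[OF this] obtain q
    where "\<forall>i\<in>I. \<exists>m. q i \<in> Hom X (Dom X (x i)) (Cod X (q i)) \<and> Cod X (q i) \<in> ?C \<and>
      m \<in> Hom X (Cod X (q i)) M \<and> m \<cdot> q i = x i" ..
  from bchoice[OF this] obtain m
    where qm: "\<forall>i\<in>I. q i \<in> Hom X (Dom X (x i)) (Cod X (q i)) \<and> Cod X (q i) \<in> ?C \<and>
      m i \<in> Hom X (Cod X (q i)) M \<and> m i \<cdot> q i = x i" ..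
  have q: "q i \<in> Hom X (Dom X (x i)) (Cod X (q i))" and C: "Cod X (q i) \<in> ?C"
    and m: "m i \<in> Hom X (Cod X (q i)) M" "m i \<cdot> q i = x i" if "i \<in> I" for i
    using bspec[OF qm that] by simp_all
  let ?Q = "\<lambda>i. Cod X (q i)"
  have "\<forall>i\<in>I. ?Q i \<in> Obj X" using Hom_Obj(2)[OF q] by blast
  then obtain P \<iota> where P: "is_coproduct X I ?Q P \<iota>" using coproducts[OF I(1), of ?Q] by blast
  obtain v where v: "v \<in> Hom X P M" "\<forall>i\<in>I. v \<cdot> \<iota> i = m i"
    using ex1_implies_ex[OF coproduct_ex1[of I ?Q P \<iota> M m, OF P MO m(1)]] by blast
  have "epi_arr X v"
  proof (rule epi_if_elements[OF v(1)])
    fix \<beta> y assume "\<beta> \<in> A" and y: "y \<in> Hom X (G \<beta>) M"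
    then have "y \<in> elements M" by (auto simp: elements_def)
    then obtain i where i: "i \<in> I" "y = x i" using I(2) by blast
    note \<iota> = coproduct_inj[OF P i(1)]
    have "\<iota> i \<cdot> q i \<in> Hom X (G \<beta>) P" using Comp_Hom[OF q[OF i(1)] \<iota>] HomD(2)[OF y] i(2) by simp
    moreover have "v \<cdot> (\<iota> i \<cdot> q i) = y"
      using Comp_assoc[OF q[OF i(1)] \<iota> v(1)] bspec[OF v(2) i(1)] m(2)[OF i(1)] i(2) by simp
    ultimately show "\<exists>z \<in> Hom X (G \<beta>) P. v \<cdot> z = y" by blast
  qed
  moreover have "\<forall>i\<in>I. ?Q i \<in> ?C" using C by blast
  ultimately show "M \<in> subcategory_of_system \<kappa> X A \<F>"
    unfolding subcategory_of_system_def by (rule generated_subcategoryI[OF I(1) _ P _ v(1), rotated])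
qed

text \<open>The system is defined through quotients, but \<open>f\<close> need not be an
  epimorphism: the image of \<open>f\<close> is a subobject of \<open>M\<close>, so it lies in
  \<open>Z\<close>.\<close>

lemma system_of_subcategoryI:
  assumes Z: "weakly_closed \<kappa> X Z" and \<alpha>: "\<alpha> \<in> A" and f: "f \<in> Hom X (G \<alpha>) M" and M: "M \<in> Z"
  shows "kernel_class X f \<in> system_of_subcategory X A G Z \<alpha>"
proof -
  obtain Q q m where *: "q \<in> Hom X (G \<alpha>) Q" "epi_arr X q" "m \<in> Hom X Q M" "mono_arr X m" "m \<cdot> q = f"
    "kernel_class X q = kernel_class X f" using image_factorization[OF f] .
  have "Q \<in> Z" using weakly_closed_mono[OF Z *(4,3) M] .
  moreover have "is_quotient X (kernel_class X f) Q" using is_quotient_kernel_class[OF f] * by blast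
  ultimately show ?thesis
    using kernel_class_subobject[OF f] \<alpha> by (auto simp: system_of_subcategory_def)
qed

lemma system_of_subcategoryE:
  assumes "\<alpha> \<in> A" "I \<in> system_of_subcategory X A G Z \<alpha>"
  obtains q Q where "q \<in> Hom X (G \<alpha>) Q" "epi_arr X q" "Q \<in> Z" "I = kernel_class X q"
proof -
  have "I \<in> subobjects X (G \<alpha>)" "\<exists>Q\<in>Z. is_quotient X I Q"
    using assms by (auto simp: system_of_subcategory_def)
  then show thesis using is_quotientE that by metis
qed

text \<open>A larger kernel makes \<open>R\<close> a quotient of \<open>Q\<close>. With equal
  kernels this also gives independence of the chosen quotient object.\<close>

lemma epi_kernel_le_weakly_closed:
  assumes Z: "weakly_closed \<kappa> X Z" and q: "q \<in> Hom X a Q" "epi_arr X q" "Q \<in> Z"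
    and r: "r \<in> Hom X a R" "epi_arr X r" and le: "kernel_le X q r"
  shows "R \<in> Z"
proof -
  obtain h where h: "h \<in> Hom X Q R" "h \<cdot> q = r" using epi_factor[OF q(2,1) r(1) le] .
  then have "epi_arr X h" using epi_if_Comp_epi[OF q(1) h(1)] r(2) by simp
  then show ?thesis using weakly_closed_epi[OF Z _ h(1) q(3)] by blast
qed

lemma system_of_subcategory_filter:
  assumes Z: "weakly_closed \<kappa> X Z" and \<alpha>: "\<alpha> \<in> A"
  shows "sub_filter X (G \<alpha>) (system_of_subcategory X A G Z \<alpha>)"
  unfolding sub_filter_def
proof (intro conjI ballI impI)
  let ?F = "system_of_subcategory X A G Z \<alpha>"
  show "?F \<subseteq> subobjects X (G \<alpha>)" using \<alpha> by (auto simp: system_of_subcategory_def)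
  \<comment> \<open>Some object of \<open>Z\<close> is needed as the target of a zero morphism; the
    empty coproduct always belongs to \<open>Z\<close>.\<close>
  have small: "|{} :: 'u set| <o \<kappa>" by (rule small_finite) simp
  obtain P \<iota> where P: "is_coproduct X ({} :: 'u set) (\<lambda>_. G \<alpha>) P \<iota>"
    using coproducts[OF small, of "\<lambda>_. G \<alpha>"] by blast
  then have PZ: "P \<in> Z" using weakly_closed_coproduct[OF Z small _ P] by blast
  have PO: "P \<in> Obj X" using P by (simp add: is_coproduct_def)
  show "{m \<in> monos_into X (G \<alpha>). mono_le X (Ident X (G \<alpha>)) m} \<in> ?F"
    unfolding top_kernel_class[OF G_Obj[OF \<alpha>] PO]
    by (rule system_of_subcategoryI[OF Z \<alpha> Zero_Hom[OF G_Obj[OF \<alpha>] PO] PZ])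
  fix I assume I: "I \<in> ?F"
  obtain q Q where q: "q \<in> Hom X (G \<alpha>) Q" "epi_arr X q" "Q \<in> Z" "I = kernel_class X q"
    using system_of_subcategoryE[OF \<alpha> I] .
  show "J \<in> ?F" if J: "J \<in> subobjects X (G \<alpha>)" and le: "sub_le X I J" for J
  proof -
    obtain R r where r: "r \<in> Hom X (G \<alpha>) R" "epi_arr X r" "J = kernel_class X r"
      using subobject_kernel_class[OF J] .
    have "kernel_le X q r" using le sub_le_kernel_class[OF q(1) r(1)] q(4) r(3) by simp
    then have "R \<in> Z" by (rule epi_kernel_le_weakly_closed[OF Z q(1-3) r(1,2)])
    then show ?thesis using system_of_subcategoryI[OF Z \<alpha> r(1)] r(3) by simp
  qed
  show "sub_inter X (G \<alpha>) I J \<in> ?F" if J: "J \<in> ?F" for J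
  proof -
    obtain r R where r: "r \<in> Hom X (G \<alpha>) R" "epi_arr X r" "R \<in> Z" "J = kernel_class X r"
      using system_of_subcategoryE[OF \<alpha> J] .
    \<comment> \<open>The intersection is the kernel of a morphism into a coproduct of copies of
      \<open>Q\<close> and \<open>R\<close>, which stays in \<open>Z\<close>.\<close>
    obtain L :: "'u set" and N P \<iota> h where L: "|L| <o \<kappa>" "\<forall>i\<in>L. N i \<in> {Q, R}" "is_coproduct X L N P \<iota>"
      and h: "h \<in> Hom X (G \<alpha>) P" "kernel_le X h q" "kernel_le X h r"
      "\<forall>t. \<forall>u \<in> Hom X t (G \<alpha>). q \<cdot> u = Zero X t Q \<and> r \<cdot> u = Zero X t R \<longrightarrow> h \<cdot> u = Zero X t P"
      by (rule pairing[OF q(1) r(1)])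
    have "\<forall>i\<in>L. N i \<in> Z" using L(2) q(3) r(3) by auto
    then have "P \<in> Z" by (rule weakly_closed_coproduct[OF Z L(1) _ L(3)])
    moreover have "sub_inter X (G \<alpha>) I J = kernel_class X h"
      unfolding q(4) r(4) by (rule sub_inter_kernel_class[OF q(1) r(1) h(1-3)]) (use h(4) in blast)
    ultimately show ?thesis using system_of_subcategoryI[OF Z \<alpha> h(1)] by simp
  qed
qed

lemma system_of_subcategory_filter_system:
  assumes Z: "weakly_closed \<kappa> X Z"
  shows "filter_system X A G (system_of_subcategory X A G Z)"
  unfolding filter_system_def
proof (intro conjI ballI)
  show "sub_filter X (G \<alpha>) (system_of_subcategory X A G Z \<alpha>)" if "\<alpha> \<in> A" for \<alpha>
    by (rule system_of_subcategory_filter[OF Z that])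
  fix \<alpha> \<beta> f J assume \<alpha>: "\<alpha> \<in> A" and \<beta>: "\<beta> \<in> A" and f: "f \<in> Hom X (G \<alpha>) (G \<beta>)"
    and J: "J \<in> system_of_subcategory X A G Z \<beta>"
  obtain q Q where q: "q \<in> Hom X (G \<beta>) Q" "epi_arr X q" "Q \<in> Z" "J = kernel_class X q"
    using system_of_subcategoryE[OF \<beta> J] .
  show "sub_preimage X f J \<in> system_of_subcategory X A G Z \<alpha>"
    unfolding q(4) sub_preimage_kernel_class[OF f q(1)]
    by (rule system_of_subcategoryI[OF Z \<alpha> Comp_Hom[OF f q(1)] q(3)])
qed

lemma subcategory_of_system_of_subcategory:
  assumes Z: "weakly_closed \<kappa> X Z"
  shows "subcategory_of_system \<kappa> X A (system_of_subcategory X A G Z) = Z"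
proof (intro equalityI subsetI)
  fix M assume "M \<in> subcategory_of_system \<kappa> X A (system_of_subcategory X A G Z)"
  moreover have "{Q. \<exists>\<alpha>\<in>A. \<exists>I \<in> system_of_subcategory X A G Z \<alpha>. is_quotient X I Q} \<subseteq> Z"
  proof clarify
    fix R \<alpha> I assume \<alpha>: "\<alpha> \<in> A" and I: "I \<in> system_of_subcategory X A G Z \<alpha>" "is_quotient X I R"
    obtain q Q where q: "q \<in> Hom X (G \<alpha>) Q" "epi_arr X q" "Q \<in> Z" "I = kernel_class X q"
      using system_of_subcategoryE[OF \<alpha> I(1)] .
    obtain r where r: "r \<in> Hom X (G \<alpha>) R" "epi_arr X r" "kernel_class X r = kernel_class X q"
      using I(2) is_quotient_kernel_class[OF q(1)] q(4) by blast
    then have "kernel_le X q r" using kernel_class_eq_iff[OF r(1) q(1)] by simp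
    then show "R \<in> Z" by (rule epi_kernel_le_weakly_closed[OF Z q(1-3) r(1,2)])
  qed
  ultimately show "M \<in> Z"
    using generated_subset_weakly_closed[OF Z] unfolding subcategory_of_system_def by blast
next
  fix M assume M: "M \<in> Z"
  have "M \<in> Obj X" using M Z by (auto simp: weakly_closed_def)
  \<comment> \<open>Every element of an object of \<open>Z\<close> has its kernel in the system, so
    the object is discrete for that system.\<close>
  then show "M \<in> subcategory_of_system \<kappa> X A (system_of_subcategory X A G Z)"
    unfolding subcategory_of_system_eq[OF system_of_subcategory_filter_system[OF Z]]
    using system_of_subcategoryI[OF Z _ _ M] by (rule discreteI)
qed

lemma system_of_subcategory_of_system:
  assumes F: "filter_system X A G \<F>" and ext: "\<F> \<in> extensional A"
  shows "system_of_subcategory X A G (subcategory_of_system \<kappa> X A \<F>) = \<F>"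
proof (rule extensionalityI[OF _ ext])
  show "system_of_subcategory X A G (subcategory_of_system \<kappa> X A \<F>) \<in> extensional A"
    by (simp add: system_of_subcategory_def)
  fix \<alpha> assume \<alpha>: "\<alpha> \<in> A"
  note Z = discrete_weakly_closed[OF F]
  show "system_of_subcategory X A G (subcategory_of_system \<kappa> X A \<F>) \<alpha> = \<F> \<alpha>"
    unfolding subcategory_of_system_eq[OF F]
  proof (intro equalityI subsetI)
    fix I assume I: "I \<in> system_of_subcategory X A G (discrete_objects \<F>) \<alpha>"
    obtain q Q where q: "q \<in> Hom X (G \<alpha>) Q" "epi_arr X q" "Q \<in> discrete_objects \<F>" "I = kernel_class X q"
      using system_of_subcategoryE[OF \<alpha> I] .
    \<comment> \<open>The quotient map \<open>q\<close> is itself an element of \<open>Q\<close>, so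
      discreteness puts its kernel into the filter.\<close>
    then show "I \<in> \<F> \<alpha>" using discreteD[OF q(3) \<alpha> q(1)] by simp
  next
    fix I assume I: "I \<in> \<F> \<alpha>"
    obtain Q q where q: "q \<in> Hom X (G \<alpha>) Q" "epi_arr X q" "I = kernel_class X q"
      using subobject_kernel_class[OF filter_system_subobject[OF F \<alpha> I]] .
    then have "Q \<in> discrete_objects \<F>" using discrete_quotient_of_generator[OF F \<alpha> q(1,2)] I by simp
    then show "I \<in> system_of_subcategory X A G (discrete_objects \<F>) \<alpha>"
      using system_of_subcategoryI[OF Z \<alpha> q(1)] q(3) by simp
  qed
qed

section \<open>Closed subcategories and principal systems\<close>

lemma closed_if_principal:
  assumes F: "filter_system X A G \<F>" and p: "principal_system X A G \<F>"
  shows "closed_subcategory \<kappa> X (discrete_objects \<F>)"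
  unfolding closed_subcategory_def
proof (intro conjI allI impI)
  show "weakly_closed \<kappa> X (discrete_objects \<F>)" by (rule discrete_weakly_closed[OF F])
  fix I :: "'u set" and N P \<pi>
  assume *: "|I| <o \<kappa> \<and> (\<forall>i\<in>I. N i \<in> discrete_objects \<F>) \<and> is_product X I N P \<pi>"
  then have N: "\<And>i. i \<in> I \<Longrightarrow> N i \<in> discrete_objects \<F>" and P: "is_product X I N P \<pi>" by auto
  have PO: "P \<in> Obj X" using P by (simp add: is_product_def)
  show "P \<in> discrete_objects \<F>"
  proof (rule discreteI[OF PO])
    fix \<alpha> x assume \<alpha>: "\<alpha> \<in> A" and x: "x \<in> Hom X (G \<alpha>) P"
    obtain I\<^sub>0 where I0: "I\<^sub>0 \<in> \<F> \<alpha>" "\<F> \<alpha> = {J \<in> subobjects X (G \<alpha>). sub_le X I\<^sub>0 J}"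
      using p \<alpha> unfolding principal_system_def principal_filter_def by blast
    obtain Q q where q: "q \<in> Hom X (G \<alpha>) Q" "I\<^sub>0 = kernel_class X q"
      using subobject_kernel_class[OF filter_system_subobject[OF F \<alpha> I0(1)]] by blast
    have "kernel_le X q x"
    proof (rule kernel_leI[OF q(1) x])
      fix t u assume u: "u \<in> Hom X t (G \<alpha>)" "q \<cdot> u = Zero X t Q"
      have t: "t \<in> Obj X" using Hom_Obj(1)[OF u(1)] .
      \<comment> \<open>Vanishing is tested on components, and each component of \<open>x\<close> is
        an element of a discrete object, so its kernel contains the smallest member.\<close>
      show "x \<cdot> u = Zero X t P"
      proof (rule product_eqI[OF P Comp_Hom[OF u(1) x] Zero_Hom[OF t PO]])
        fix i assume i: "i \<in> I"
        note \<pi> = product_proj[OF P i]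
        note \<pi>x = Comp_Hom[OF x \<pi>]
        have "kernel_class X (\<pi> i \<cdot> x) \<in> \<F> \<alpha>" using discreteD[OF N[OF i] \<alpha> \<pi>x] .
        then have "kernel_le X q (\<pi> i \<cdot> x)" using I0(2) q(2) sub_le_kernel_class[OF q(1) \<pi>x] by simp
        then have "\<pi> i \<cdot> x \<cdot> u = Zero X t (N i)" by (rule kernel_leD[OF _ q(1) \<pi>x u])
        then show "\<pi> i \<cdot> (x \<cdot> u) = \<pi> i \<cdot> Zero X t P"
          using Comp_assoc[OF u(1) x \<pi>] Comp_Zero[OF \<pi> t] by simp
      qed
    qed
    then show "kernel_class X x \<in> \<F> \<alpha>"
      using I0(2) q(2) sub_le_kernel_class[OF q(1) x] kernel_class_subobject[OF x] by simp
  qed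
qed

lemma principal_if_closed:
  assumes F: "filter_system X A G \<F>" and c: "closed_subcategory \<kappa> X (discrete_objects \<F>)"
  shows "principal_system X A G \<F>"
  unfolding principal_system_def
proof
  fix \<alpha> assume \<alpha>: "\<alpha> \<in> A"
  note sub = filter_system_subobject[OF F \<alpha>]
  have "\<exists>Q q. q \<in> Hom X (G \<alpha>) Q \<and> epi_arr X q \<and> I = kernel_class X q" if "I \<in> \<F> \<alpha>" for I
    using subobject_kernel_class[OF sub[OF that]] by metis
  then obtain Q q where q: "\<And>I. I \<in> \<F> \<alpha> \<Longrightarrow> q I \<in> Hom X (G \<alpha>) (Q I)" "\<And>I. I \<in> \<F> \<alpha> \<Longrightarrow> epi_arr X (q I)"
    "\<And>I. I \<in> \<F> \<alpha> \<Longrightarrow> I = kernel_class X (q I)" by metis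
  \<comment> \<open>The product over all members of the filter is available only if there are few of
    them. A member is determined by the elements of \<open>G \<alpha>\<close> that its quotient map
    annihilates, so the filter injects into the power set of a small set.\<close>
  define D where "D I = {x \<in> elements (G \<alpha>). q I \<cdot> x = Zero X (Dom X x) (Q I)}" for I
  have D_le: "kernel_le X (q I) (q J)" if I: "I \<in> \<F> \<alpha>" and J: "J \<in> \<F> \<alpha>" and eq: "D I = D J" for I J
  proof (rule kernel_le_if_elements[OF q(1)[OF I] q(1)[OF J]])
    fix \<beta> x assume "\<beta> \<in> A" and x: "x \<in> Hom X (G \<beta>) (G \<alpha>)" "q I \<cdot> x = Zero X (G \<beta>) (Q I)"
    then have "x \<in> D I" using HomD(2)[OF x(1)] by (auto simp: D_def elements_def)
    then have "x \<in> D J" using eq by simp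
    then show "q J \<cdot> x = Zero X (G \<beta>) (Q J)" using HomD(2)[OF x(1)] by (simp add: D_def)
  qed
  have "inj_on D (\<F> \<alpha>)"
  proof (rule inj_onI)
    fix I J assume I: "I \<in> \<F> \<alpha>" and J: "J \<in> \<F> \<alpha>" and eq: "D I = D J"
    have "kernel_class X (q I) = kernel_class X (q J)"
      using kernel_class_eq_iff[OF q(1)[OF I] q(1)[OF J]] D_le[OF I J eq] D_le[OF J I eq[symmetric]] by blast
    then show "I = J" using q(3)[OF I] q(3)[OF J] by simp
  qed
  moreover have "D ` \<F> \<alpha> \<subseteq> Pow (elements (G \<alpha>))" by (auto simp: D_def)
  ultimately have "|\<F> \<alpha>| \<le>o |Pow (elements (G \<alpha>))|" using card_of_ordLeq by blast
  then have "|\<F> \<alpha>| <o \<kappa>"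
    using small_Pow[OF small_elements[OF G_Obj[OF \<alpha>]]] by (rule ordLeq_ordLess_trans)
  then obtain L :: "'u set" and \<phi> where L: "|L| <o \<kappa>" "\<phi> ` L = \<F> \<alpha>" by (rule small_reindex)
  have \<phi>: "\<phi> l \<in> \<F> \<alpha>" if "l \<in> L" for l using L(2) that by blast
  have Q: "Q (\<phi> l) \<in> discrete_objects \<F>" if l: "l \<in> L" for l
    using discrete_quotient_of_generator[OF F \<alpha> q(1,2)[OF \<phi>[OF l]]] q(3)[OF \<phi>[OF l]] \<phi>[OF l] by simp
  have QO: "Q (\<phi> l) \<in> Obj X" if "l \<in> L" for l using Hom_Obj(2)[OF q(1)[OF \<phi>[OF that]]] .
  obtain P \<pi> where P: "is_product X L (\<lambda>l. Q (\<phi> l)) P \<pi>"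
    using products_exist[of L "\<lambda>l. Q (\<phi> l)", OF L(1) QO] by blast
  have PZ: "P \<in> discrete_objects \<F>" using closed_product[OF c L(1) _ P] Q by blast
  \<comment> \<open>All quotient maps factor through \<open>x\<close>, so the kernel of
    \<open>x\<close> lies below every member, and as an element of the discrete object
    \<open>P\<close> it has its kernel in the filter.\<close>
  obtain x where x: "x \<in> Hom X (G \<alpha>) P" "\<forall>l\<in>L. \<pi> l \<cdot> x = q (\<phi> l)"
    using ex1_implies_ex[OF product_ex1[of L "\<lambda>l. Q (\<phi> l)" P \<pi> "G \<alpha>" "\<lambda>l. q (\<phi> l)",
      OF P G_Obj[OF \<alpha>] q(1)[OF \<phi>]]] by blast
  have xF: "kernel_class X x \<in> \<F> \<alpha>" by (rule discreteD[OF PZ \<alpha> x(1)])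
  have "\<F> \<alpha> = {J \<in> subobjects X (G \<alpha>). sub_le X (kernel_class X x) J}"
  proof (intro equalityI subsetI)
    fix J assume J: "J \<in> \<F> \<alpha>"
    then obtain l where l: "l \<in> L" "J = \<phi> l" using L(2) by blast
    have "kernel_le X x (q J)"
      using kernel_le_Comp[OF x(1) product_proj[OF P l(1)]] bspec[OF x(2) l(1)] l(2) by simp
    then have "sub_le X (kernel_class X x) J"
      using sub_le_kernel_class[OF x(1) q(1)[OF J]] q(3)[OF J] by simp
    then show "J \<in> {J \<in> subobjects X (G \<alpha>). sub_le X (kernel_class X x) J}" using sub[OF J] by simp
  next
    fix J assume "J \<in> {J \<in> subobjects X (G \<alpha>). sub_le X (kernel_class X x) J}"
    then show "J \<in> \<F> \<alpha>" using filter_system_filter[OF F \<alpha>] xF unfolding sub_filter_def by blast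
  qed
  then show "principal_filter X (G \<alpha>) (\<F> \<alpha>)" using xF unfolding principal_filter_def by blast
qed

section \<open>Localizing subcategories and Gabriel systems\<close>

lemma gabriel_if_localizing:
  assumes F: "filter_system X A G \<F>" and loc: "localizing \<kappa> X (discrete_objects \<F>)"
  shows "gabriel_system \<kappa> X A G \<F>"
  unfolding gabriel_system_def
proof (intro allI impI, elim conjE)
  fix L :: "'u set" and \<gamma> I N P \<iota> \<beta> J K g
  assume L: "|L| <o \<kappa>" "\<forall>i\<in>L. \<gamma> i \<in> A \<and> I i \<in> \<F> (\<gamma> i) \<and> is_quotient X (I i) (N i)"
    and P: "is_coproduct X L N P \<iota>" and \<beta>: "\<beta> \<in> A" and J: "J \<in> \<F> \<beta>" and K: "K \<in> subobjects X (G \<beta>)"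
    and g: "epi_arr X g" "Dom X g = P" and sq: "is_subquotient X J K (Cod X g)"
  note Z = discrete_weakly_closed[OF F]
  have "\<forall>i\<in>L. N i \<in> discrete_objects \<F>" using discrete_is_quotient[OF F] L(2) by blast
  then have "P \<in> discrete_objects \<F>" using weakly_closed_coproduct[OF Z L(1) _ P] by blast
  moreover have "g \<in> Hom X P (Cod X g)" using g by (simp add: epi_arr_def Hom_iff)
  ultimately have gZ: "Cod X g \<in> discrete_objects \<F>" using weakly_closed_epi[OF Z g(1)] by blast
  obtain k j h q where kj: "k \<in> K" "j \<in> J" and h: "h \<in> Hom X (Dom X k) (Dom X j)" "k = j \<cdot> h"
    and q: "is_cokernel X h q" "Cod X q = Cod X g"
    using sq unfolding is_subquotient_def by blast
  obtain C p where p: "p \<in> Hom X (G \<beta>) C" "epi_arr X p" "K = kernel_class X p"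
    using subobject_kernel_class[OF K] .
  obtain D r where r: "r \<in> Hom X (G \<beta>) D" "epi_arr X r" "J = kernel_class X r"
    using subobject_kernel_class[OF filter_system_subobject[OF F \<beta> J]] .
  have DZ: "D \<in> discrete_objects \<F>" using discrete_quotient_of_generator[OF F \<beta> r(1,2)] r(3) J by simp
  have k: "is_kernel X p k" and j: "is_kernel X r j" using kj p(3) r(3) by (auto simp: kernel_class_def)
  note k' = kernel_Hom[OF k p(1)] and j' = kernel_Hom[OF j r(1)] and q' = cokernel_Hom[OF q(1) h(1)]
  have pj: "p \<cdot> j \<in> Hom X (Dom X j) C" using Comp_Hom[OF j'(1) p(1)] .
  have "p \<cdot> j \<cdot> h = Zero X (Dom X k) C" using Comp_assoc[OF h(1) j'(1) p(1)] h(2) k'(2) by simp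
  \<comment> \<open>With \<open>C\<close> as the quotient of \<open>G \<beta>\<close> by
    \<open>K\<close>, this is the inclusion of J/K in it, induced by \<open>j\<close>.\<close>
  then obtain u where u: "u \<in> Hom X (Cod X q) C" "u \<cdot> q = p \<cdot> j" using cokernel_desc[OF q(1) h(1) pj] by blast
  have "r \<cdot> k = Zero X (Dom X k) D"
    using Comp_assoc[OF h(1) j'(1) r(1)] h(2) j'(2) Zero_Comp[OF h(1) Hom_Obj(2)[OF r(1)]] by simp
  then have "kernel_le X p r" using kernel_le_iff[OF k p(1) r(1)] by simp
  \<comment> \<open>The projection from the quotient by \<open>K\<close> onto the quotient
    \<open>D\<close> by \<open>J\<close>; both outer terms of the sequence formed by
    \<open>u\<close> and \<open>v\<close> are discrete.\<close>
  then obtain v where v: "v \<in> Hom X C D" "v \<cdot> p = r" using epi_factor[OF p(2,1) r(1)] by blast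
  have "short_exact X u v"
  proof (rule short_exact_if_elements[OF u(1) _ v(1)])
    show "mono_arr X u"
    proof (rule mono_if_elements[OF u(1)])
      fix \<alpha> y assume \<alpha>: "\<alpha> \<in> A" and y: "y \<in> Hom X (G \<alpha>) (Cod X q)" "u \<cdot> y = Zero X (G \<alpha>) C"
      obtain z where z: "z \<in> Hom X (G \<alpha>) (Dom X j)" "q \<cdot> z = y"
        using epi_lift[OF cokernel_epi[OF q(1)] q'(1) \<alpha> y(1)] .
      have jz: "j \<cdot> z \<in> Hom X (G \<alpha>) (G \<beta>)" using Comp_Hom[OF z(1) j'(1)] .
      have "p \<cdot> (j \<cdot> z) = Zero X (G \<alpha>) C"
        using Comp_assoc[OF z(1) j'(1) p(1)] u(2) Comp_assoc[OF z(1) q'(1) u(1)] z(2) y(2) by simp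
      then obtain w where w: "w \<in> Hom X (G \<alpha>) (Dom X k)" "k \<cdot> w = j \<cdot> z"
        using kernel_lift[OF k p(1) jz] by blast
      have "j \<cdot> (h \<cdot> w) = j \<cdot> z" using Comp_assoc[OF w(1) h(1) j'(1)] h(2) w(2) by simp
      then have "h \<cdot> w = z" by (rule mono_cancel[OF kernel_mono[OF j] j'(1) Comp_Hom[OF w(1) h(1)] z(1)])
      then show "y = Zero X (G \<alpha>) (Cod X q)"
        using z(2) Comp_assoc[OF w(1) h(1) q'(1)] q'(2) Zero_Comp[OF w(1) Hom_Obj(2)[OF q'(1)]] by simp
    qed
    show "epi_arr X v" using epi_if_Comp_epi[OF p(1) v(1)] v(2) r(2) by simp
    show "v \<cdot> u = Zero X (Cod X q) D"
    proof (rule epi_cancel[OF cokernel_epi[OF q(1)] q'(1) Comp_Hom[OF u(1) v(1)]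
          Zero_Hom[OF Hom_Obj(1)[OF u(1)] Hom_Obj(2)[OF v(1)]]])
      show "v \<cdot> u \<cdot> q = Zero X (Cod X q) D \<cdot> q"
        using Comp_assoc[OF q'(1) u(1) v(1)] u(2) Comp_assoc[OF j'(1) p(1) v(1)] v(2) j'(2)
          Zero_Comp[OF q'(1) Hom_Obj(2)[OF v(1)]] by simp
    qed
    fix \<alpha> y assume \<alpha>: "\<alpha> \<in> A" and y: "y \<in> Hom X (G \<alpha>) C" "v \<cdot> y = Zero X (G \<alpha>) D"
    obtain z where z: "z \<in> Hom X (G \<alpha>) (G \<beta>)" "p \<cdot> z = y" using epi_lift[OF p(2,1) \<alpha> y(1)] .
    have "r \<cdot> z = Zero X (G \<alpha>) D" using Comp_assoc[OF z(1) p(1) v(1)] v(2) z(2) y(2) by simp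
    then obtain w where w: "w \<in> Hom X (G \<alpha>) (Dom X j)" "j \<cdot> w = z" using kernel_lift[OF j r(1) z(1)] by blast
    have "u \<cdot> (q \<cdot> w) = y"
      using Comp_assoc[OF w(1) q'(1) u(1)] u(2) Comp_assoc[OF w(1) j'(1) p(1)] w(2) z(2) by simp
    then show "\<exists>x \<in> Hom X (G \<alpha>) (Cod X q). u \<cdot> x = y" using Comp_Hom[OF w(1) q'(1)] by blast
  qed
  moreover have "Dom X u \<in> discrete_objects \<F>" "Cod X v \<in> discrete_objects \<F>"
    using HomD(2)[OF u(1)] q(2) gZ HomD(3)[OF v(1)] DZ by simp_all
  ultimately have "Cod X u \<in> discrete_objects \<F>" using loc unfolding localizing_def by blast
  then have "C \<in> discrete_objects \<F>" using HomD(3)[OF u(1)] by simp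
  then show "K \<in> \<F> \<beta>" using discreteD[OF _ \<beta> p(1)] p(3) by simp
qed

text \<open>For an element \<open>x\<close> of the middle term let K be its kernel and J the kernel
  of g \<cdot> x. Then J lies in the filter because the right term is discrete, and J/K embeds in
  the left term; the Gabriel condition then yields K.\<close>

lemma localizing_if_gabriel:
  assumes F: "filter_system X A G \<F>" and gab: "gabriel_system \<kappa> X A G \<F>"
  shows "localizing \<kappa> X (discrete_objects \<F>)"
  unfolding localizing_def
proof (intro conjI allI impI, rule discrete_weakly_closed[OF F], elim conjE)
  fix f g assume fg: "short_exact X f g" and Zf: "Dom X f \<in> discrete_objects \<F>" and Zg: "Cod X g \<in> discrete_objects \<F>"
  note Z = discrete_weakly_closed[OF F]
  have kf: "is_kernel X g f" using fg by (simp add: short_exact_def)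
  then have f0: "f \<in> Hom X (Dom X f) (Dom X g)" and "g \<in> Arr X" by (auto simp: is_kernel_def)
  then have f: "f \<in> Hom X (Dom X f) (Cod X f)" and g: "g \<in> Hom X (Cod X f) (Cod X g)"
    by (auto simp: Hom_iff)
  show "Cod X f \<in> discrete_objects \<F>"
  proof (rule discreteI[OF Hom_Obj(2)[OF f]])
    fix \<alpha> x assume \<alpha>: "\<alpha> \<in> A" and x: "x \<in> Hom X (G \<alpha>) (Cod X f)"
    note gx = Comp_Hom[OF x g]
    have J: "kernel_class X (g \<cdot> x) \<in> \<F> \<alpha>" using discreteD[OF Zg \<alpha> gx] .
    have K: "kernel_class X x \<in> subobjects X (G \<alpha>)" using kernel_class_subobject[OF x] .
    have le: "kernel_le X x (g \<cdot> x)" using kernel_le_Comp[OF x g] .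
    then have sub: "sub_le X (kernel_class X x) (kernel_class X (g \<cdot> x))" using sub_le_kernel_class[OF x gx] by simp
    obtain k where k: "is_kernel X x k" using kernel_exists[OF x] .
    obtain j where j: "is_kernel X (g \<cdot> x) j" using kernel_exists[OF gx] .
    note k' = kernel_Hom[OF k x] and j' = kernel_Hom[OF j gx]
    have "g \<cdot> x \<cdot> k = Zero X (Dom X k) (Cod X g)" using le kernel_le_iff[OF k x gx] by simp
    then obtain h where h: "h \<in> Hom X (Dom X k) (Dom X j)" "j \<cdot> h = k" using kernel_lift[OF j gx k'(1)] by blast
    obtain q where q: "is_cokernel X h q" using cokernel_exists[OF h(1)] .
    note q' = cokernel_Hom[OF q h(1)]
    have xj: "x \<cdot> j \<in> Hom X (Dom X j) (Cod X f)" using Comp_Hom[OF j'(1) x] .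
    have "g \<cdot> (x \<cdot> j) = Zero X (Dom X j) (Cod X g)" using Comp_assoc[OF j'(1) x g] j'(2) by simp
    then obtain w where w: "w \<in> Hom X (Dom X j) (Dom X f)" "f \<cdot> w = x \<cdot> j" using kernel_lift[OF kf g xj] by blast
    note mf = kernel_mono[OF kf]
    have "f \<cdot> (w \<cdot> h) = Zero X (Dom X k) (Cod X f)"
      using Comp_assoc[OF h(1) w(1) f] w(2) Comp_assoc[OF h(1) j'(1) x] h(2) k'(2) by simp
    then have "w \<cdot> h = Zero X (Dom X k) (Dom X f)" using mono_Comp_Zero_iff[OF mf f Comp_Hom[OF h(1) w(1)]] by simp
    \<comment> \<open>Restricted to J, \<open>x\<close> lands in the kernel \<open>f\<close> of
      \<open>g\<close>; this restriction annihilates K, so it induces \<open>m\<close> from J/K to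
      the left term.\<close>
    then obtain m where m: "m \<in> Hom X (Cod X q) (Dom X f)" "m \<cdot> q = w" using cokernel_desc[OF q h(1) w(1)] by blast
    have "mono_arr X m"
    proof (rule mono_if_elements[OF m(1)])
      fix \<beta> y assume \<beta>: "\<beta> \<in> A" and y: "y \<in> Hom X (G \<beta>) (Cod X q)" "m \<cdot> y = Zero X (G \<beta>) (Dom X f)"
      obtain z where z: "z \<in> Hom X (G \<beta>) (Dom X j)" "q \<cdot> z = y"
        using epi_lift[OF cokernel_epi[OF q] q'(1) \<beta> y(1)] .
      have jz: "j \<cdot> z \<in> Hom X (G \<beta>) (G \<alpha>)" using Comp_Hom[OF z(1) j'(1)] .
      have "w \<cdot> z = Zero X (G \<beta>) (Dom X f)" using Comp_assoc[OF z(1) q'(1) m(1)] m(2) z(2) y(2) by simp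
      then have "x \<cdot> (j \<cdot> z) = Zero X (G \<beta>) (Cod X f)"
        using Comp_assoc[OF z(1) j'(1) x] Comp_assoc[OF z(1) w(1) f] w(2) Comp_Zero[OF f Hom_Obj(1)[OF z(1)]] by simp
      then obtain t where t: "t \<in> Hom X (G \<beta>) (Dom X k)" "k \<cdot> t = j \<cdot> z" using kernel_lift[OF k x jz] by blast
      have "j \<cdot> (h \<cdot> t) = j \<cdot> z" using Comp_assoc[OF t(1) h(1) j'(1)] h(2) t(2) by simp
      then have "h \<cdot> t = z" by (rule mono_cancel[OF kernel_mono[OF j] j'(1) Comp_Hom[OF t(1) h(1)] z(1)])
      then show "y = Zero X (G \<beta>) (Cod X q)"
        using z(2) Comp_assoc[OF t(1) h(1) q'(1)] q'(2) Zero_Comp[OF t(1) Hom_Obj(2)[OF q'(1)]] by simp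
    qed
    then have "Cod X q \<in> discrete_objects \<F>" using weakly_closed_mono[OF Z _ m(1) Zf] by blast
    \<comment> \<open>Discreteness of J/K is turned back into a presentation as a quotient of a
      coproduct of objects \<open>G \<gamma>\<close> / \<open>I\<close>, the form in which the
      Gabriel condition takes its epimorphism.\<close>
    then have "Cod X q \<in> subcategory_of_system \<kappa> X A \<F>" using subcategory_of_system_eq[OF F] by simp
    then obtain L :: "'u set" and N P \<iota> e where L: "|L| <o \<kappa>"
      and N: "\<forall>i\<in>L. \<exists>\<gamma>. \<exists>I. \<gamma> \<in> A \<and> I \<in> \<F> \<gamma> \<and> is_quotient X I (N i)"
      and P: "is_coproduct X L N P \<iota>" and e: "epi_arr X e" "Dom X e = P" "Cod X e = Cod X q"
      unfolding subcategory_of_system_def generated_subcategory_def by blast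
    obtain \<gamma> I where \<gamma>: "\<forall>i\<in>L. \<gamma> i \<in> A \<and> I i \<in> \<F> (\<gamma> i) \<and> is_quotient X (I i) (N i)" using N by metis
    have sq: "is_subquotient X (kernel_class X (g \<cdot> x)) (kernel_class X x) (Cod X e)"
      unfolding is_subquotient_def e(3) kernel_class_def
      by (intro bexI[of _ k] bexI[of _ j] bexI[of _ h] conjI exI[of _ q] CollectI k j h h(2)[symmetric] q refl)
    show "kernel_class X x \<in> \<F> \<alpha>"
      by (rule gab[unfolded gabriel_system_def, THEN spec[of _ L], THEN spec[of _ \<gamma>], THEN spec[of _ I],
        THEN spec[of _ N], THEN spec[of _ P], THEN spec[of _ \<iota>], THEN spec[of _ \<alpha>],
        THEN spec[of _ "kernel_class X (g \<cdot> x)"], THEN spec[of _ "kernel_class X x"], THEN spec[of _ e], THEN mp])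
        (intro conjI L \<gamma> P \<alpha> J K sub e(1,2) sq)
  qed
qed

end

theorem theorem3p4:
  fixes \<kappa> :: "'u rel" and X :: "('o, 'm) ab_category"
    and A :: "'a set" and G :: "'a \<Rightarrow> 'o"
  assumes "grothendieck_category \<kappa> X"
    and "|A| <o \<kappa>"
    and "is_generating_family X A G"
    and "\<And>\<alpha>. \<alpha> \<in> A \<Longrightarrow> compact_object \<kappa> X (G \<alpha>)"
    and "\<And>\<alpha>. \<alpha> \<in> A \<Longrightarrow> projective_object X (G \<alpha>)"
  shows
    "(\<forall>\<F>. filter_system X A G \<F> \<longrightarrow> weakly_closed \<kappa> X (subcategory_of_system \<kappa> X A \<F>)) \<and>
     (\<forall>Z. weakly_closed \<kappa> X Z \<longrightarrow>
        (\<forall>\<alpha>\<in>A. sub_filter X (G \<alpha>) (system_of_subcategory X A G Z \<alpha>)) \<and>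
        filter_system X A G (system_of_subcategory X A G Z)) \<and>
     (bij_betw (subcategory_of_system \<kappa> X A) (filter_systems X A G) (weakly_closed_subcategories \<kappa> X) \<and>
      bij_betw (system_of_subcategory X A G) (weakly_closed_subcategories \<kappa> X) (filter_systems X A G) \<and>
      (\<forall>\<F> \<in> filter_systems X A G.
         system_of_subcategory X A G (subcategory_of_system \<kappa> X A \<F>) = \<F>) \<and>
      (\<forall>Z \<in> weakly_closed_subcategories \<kappa> X.
         subcategory_of_system \<kappa> X A (system_of_subcategory X A G Z) = Z)) \<and>
     (\<forall>\<F> \<in> filter_systems X A G. \<forall>Z \<in> weakly_closed_subcategories \<kappa> X.
        Z = subcategory_of_system \<kappa> X A \<F> \<longrightarrow>
          (closed_subcategory \<kappa> X Z \<longleftrightarrow> principal_system X A G \<F>) \<and>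
          (localizing \<kappa> X Z \<longleftrightarrow> gabriel_system \<kappa> X A G \<F>))"
proof -
  interpret grothendieck_category \<kappa> X by (rule assms(1))
  interpret compact_projective_generators \<kappa> X A G
    by unfold_locales (use assms(2-5) in auto)
  have 1: "weakly_closed \<kappa> X (subcategory_of_system \<kappa> X A \<F>)" if "filter_system X A G \<F>" for \<F>
    unfolding subcategory_of_system_eq[OF that] by (rule discrete_weakly_closed[OF that])
  have F: "filter_system X A G \<F> \<and> \<F> \<in> extensional A" if "\<F> \<in> filter_systems X A G" for \<F>
    using that by (simp add: filter_systems_def)
  have Z: "weakly_closed \<kappa> X Z" if "Z \<in> weakly_closed_subcategories \<kappa> X" for Z
    using that by (simp add: weakly_closed_subcategories_def)
  have FZ: "\<forall>\<F> \<in> filter_systems X A G. system_of_subcategory X A G (subcategory_of_system \<kappa> X A \<F>) = \<F>"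
    using system_of_subcategory_of_system F by blast
  have ZF: "\<forall>Z \<in> weakly_closed_subcategories \<kappa> X. subcategory_of_system \<kappa> X A (system_of_subcategory X A G Z) = Z"
    using subcategory_of_system_of_subcategory Z by blast
  have im1: "subcategory_of_system \<kappa> X A ` filter_systems X A G \<subseteq> weakly_closed_subcategories \<kappa> X"
    using 1 F by (auto simp: weakly_closed_subcategories_def)
  have im2: "system_of_subcategory X A G ` weakly_closed_subcategories \<kappa> X \<subseteq> filter_systems X A G"
    using system_of_subcategory_filter_system Z
    by (auto simp: filter_systems_def system_of_subcategory_def[of X A G])
  have 4: "(closed_subcategory \<kappa> X (subcategory_of_system \<kappa> X A \<F>) \<longleftrightarrow> principal_system X A G \<F>) \<and>
    (localizing \<kappa> X (subcategory_of_system \<kappa> X A \<F>) \<longleftrightarrow> gabriel_system \<kappa> X A G \<F>)"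
    if "filter_system X A G \<F>" for \<F>
    unfolding subcategory_of_system_eq[OF that]
    using closed_if_principal[OF that] principal_if_closed[OF that]
      gabriel_if_localizing[OF that] localizing_if_gabriel[OF that] by blast
  have bij1: "bij_betw (subcategory_of_system \<kappa> X A) (filter_systems X A G) (weakly_closed_subcategories \<kappa> X)"
    by (rule bij_betw_byWitness[OF FZ ZF im1 im2])
  have bij2: "bij_betw (system_of_subcategory X A G) (weakly_closed_subcategories \<kappa> X) (filter_systems X A G)"
    by (rule bij_betw_byWitness[OF ZF FZ im2 im1])
  show ?thesis
  proof (intro conjI allI ballI impI)
    fix \<F> Z assume "\<F> \<in> filter_systems X A G" and eq: "Z = subcategory_of_system \<kappa> X A \<F>"
    then have "filter_system X A G \<F>" using F by blast
    then show "closed_subcategory \<kappa> X Z \<longleftrightarrow> principal_system X A G \<F>"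
      "localizing \<kappa> X Z \<longleftrightarrow> gabriel_system \<kappa> X A G \<F>"
      unfolding eq using 4 by blast+
  qed (use 1 FZ ZF bij1 bij2 system_of_subcategory_filter system_of_subcategory_filter_system in auto)
qed

end
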